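(* Let $H\in\mathfrak t$ be a mass linear function on a simple polytope $\Delta\subset\mathfrak t^*$. There exists an inessential function $H'\in\mathfrak t$ so that the mass linear function $\tilde H=H-H'$ has the following property: every $\tilde H$-asymmetric facet is pervasive.
   Context: Let $\mathfrak t$ be a finite-dimensional real vector space with dual $\mathfrak t^*$ and pairing $\langle\cdot,\cdot\rangle$. A polytope is a bounded set $\Delta=\bigcap_{i=1}^N\{x\in\mathfrak t^*\mid\langle\eta_i,x\rangle\le\kappa_i\}$ with outward conormals $\eta_i\in\mathfrak t$ and support numbers $\kappa_i\in\mathbb R$, where $\Delta$ affinely spans $\mathfrak t^*$ and each facet $F_i=\Delta\cap\{\langle\eta_i,x\rangle=\kappa_i\}$ affinely spans a hyperplane. It is simple if exactly $\dim\mathfrak t$ facets meet at each vertex. A facet is pervasive if it has nonempty intersection with every other facet of $\Delta$. With the $\eta_i$ fixed, for $\kappa'\in\mathbb R^N$ let $\Delta(\kappa')=\bigcap_i\{\langle\eta_i,x\rangle\le\kappa'_i\}$, with facets $F_i(\kappa')$. The chamber $\mathcal C_\Delta\subset\mathbb R^N$ is the connected component containing $\kappa$ of the set of $\kappa'$ for which $\Delta(\kappa')$ is a simple polytope (with $N$ facets, that is, $\Delta(\kappa')$ affinely spans $\mathfrak t^*$, each of the $N$ sets $\Delta(\kappa')\cap\{\langle\eta_i,x\rangle=\kappa'_i\}$ affinely spans a hyperplane, and exactly $\dim\mathfrak t$ of these $N$ facets meet at each vertex). $c_\Delta(\kappa')$ is the center of mass of $\Delta(\kappa')$. $H\in\mathfrak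 t$ is mass linear on $\Delta$ if $\langle H,c_\Delta(\kappa')\rangle=\sum_i\gamma_i\kappa'_i+C$ on $\mathcal C_\Delta$ for some real constants $\gamma_i,C$. A facet $F_i$ is $H$-symmetric if $\kappa'\mapsto\langle H,c_\Delta(\kappa')\rangle$ on $\mathcal C_\Delta$ does not depend on $\kappa'_i$, and $H$-asymmetric otherwise. A symmetry of a polytope is an affine map $a:\mathfrak t^*\to\mathfrak t^*$ taking the polytope to itself. A robust symmetry of $\Delta$ is a linear map $\hat a:\mathfrak t^*\to\mathfrak t^*$ such that for every $\kappa'\in\mathcal C_\Delta$ there is a symmetry $a_{\kappa'}$ of $\Delta(\kappa')$ with associated linear map $\hat a$. Facets $F_i$, $F_j$ are equivalent if there is a robust symmetry $\hat a$ such that each $a_{\kappa'}$ takes $F_i(\kappa')$ to $F_j(\kappa')$; classes are viewed as subsets of $\{1,\dots,N\}$. The conormals are normalized so that for every robust symmetry $\hat a$ and every $i$ there is $j$ with $\hat a^*(\eta_i)=\eta_j$ (this is always possible). $H'\in\mathfrak t$ is inessential if $H'=\sum_i\beta_i\eta_i$ with $\beta_i\in\mathbb R$ and $\sum_{i\in I}\beta_i=0$ for every equivalence class $I$. (Inessential functions are mass linear.) *)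

theory Defs
  imports "HOL-Analysis.Analysis"
begin

text \<open>
  The space of conormals is a Euclidean space, identified with its dual through the inner product; the
  pairing of a conormal \<open>\<eta>\<close> with a point \<open>x\<close> is \<open>\<eta> \<bullet> x\<close>.  Nothing below depends on the choice
  of inner product: the centre of mass is equivariant under affine isomorphisms, and the dual
  of a linear map \<open>L\<close> is \<open>adjoint L\<close>.  The facets are indexed by a finite type, so that vectors of
  support numbers live in \<open>real ^ 'n\<close>.
\<close>

definition polytope_of :: "('n::finite \<Rightarrow> 'a::euclidean_space) \<Rightarrow> real ^ 'n \<Rightarrow> 'a set" where
  "polytope_of \<eta> \<kappa> = (\<Inter>i. {x. \<eta> i \<bullet> x \<le> \<kappa> $ i})"

definition facet :: "('n::finite \<Rightarrow> 'a::euclidean_space) \<Rightarrow> real ^ 'n \<Rightarrow> 'n \<Rightarrow> 'a set" where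
  "facet \<eta> \<kappa> i = polytope_of \<eta> \<kappa> \<inter> {x. \<eta> i \<bullet> x = \<kappa> $ i}"

definition is_polytope :: "('n::finite \<Rightarrow> 'a::euclidean_space) \<Rightarrow> real ^ 'n \<Rightarrow> bool" where
  "is_polytope \<eta> \<kappa> \<longleftrightarrow>
     bounded (polytope_of \<eta> \<kappa>) \<and>
     affine hull (polytope_of \<eta> \<kappa>) = UNIV \<and>
     (\<forall>i. aff_dim (facet \<eta> \<kappa> i) = int DIM('a) - 1)"

text \<open>
  Facets through a vertex are counted by their indices.  Hence a simple polytope cannot list
  the same facet twice: a vertex on a repeated facet would carry more than \<open>DIM('a)\<close> indices.
\<close>

definition simple_polytope :: "('n::finite \<Rightarrow> 'a::euclidean_space) \<Rightarrow> real ^ 'n \<Rightarrow> bool" where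
  "simple_polytope \<eta> \<kappa> \<longleftrightarrow>
     is_polytope \<eta> \<kappa> \<and>
     (\<forall>v. v extreme_point_of (polytope_of \<eta> \<kappa>) \<longrightarrow> card {i. v \<in> facet \<eta> \<kappa> i} = DIM('a))"

definition pervasive_facet :: "('n::finite \<Rightarrow> 'a::euclidean_space) \<Rightarrow> real ^ 'n \<Rightarrow> 'n \<Rightarrow> bool" where
  "pervasive_facet \<eta> \<kappa> i \<longleftrightarrow> (\<forall>j. j \<noteq> i \<longrightarrow> facet \<eta> \<kappa> i \<inter> facet \<eta> \<kappa> j \<noteq> {})"

definition chamber :: "('n::finite \<Rightarrow> 'a::euclidean_space) \<Rightarrow> real ^ 'n \<Rightarrow> (real ^ 'n) set" where
  "chamber \<eta> \<kappa> = connected_component_set {\<kappa>'. simple_polytope \<eta> \<kappa>'} \<kappa>"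

definition center_of_mass :: "'a::euclidean_space set \<Rightarrow> 'a" where
  "center_of_mass P = (1 / measure lebesgue P) *\<^sub>R integral P (\<lambda>x. x)"

definition mass_linear ::
  "('n::finite \<Rightarrow> 'a::euclidean_space) \<Rightarrow> real ^ 'n \<Rightarrow> 'a \<Rightarrow> bool" where
  "mass_linear \<eta> \<kappa> H \<longleftrightarrow>
     (\<exists>(\<gamma> :: 'n \<Rightarrow> real) C. \<forall>\<kappa>' \<in> chamber \<eta> \<kappa>.
        H \<bullet> center_of_mass (polytope_of \<eta> \<kappa>') = (\<Sum>i\<in>UNIV. \<gamma> i * \<kappa>' $ i) + C)"

definition symmetric_facet ::
  "('n::finite \<Rightarrow> 'a::euclidean_space) \<Rightarrow> real ^ 'n \<Rightarrow> 'a \<Rightarrow> 'n \<Rightarrow> bool" where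
  "symmetric_facet \<eta> \<kappa> H i \<longleftrightarrow>
     (\<forall>\<kappa>' \<in> chamber \<eta> \<kappa>. \<forall>\<kappa>'' \<in> chamber \<eta> \<kappa>. (\<forall>j. j \<noteq> i \<longrightarrow> \<kappa>' $ j = \<kappa>'' $ j) \<longrightarrow>
        H \<bullet> center_of_mass (polytope_of \<eta> \<kappa>') = H \<bullet> center_of_mass (polytope_of \<eta> \<kappa>''))"

abbreviation asymmetric_facet ::
  "('n::finite \<Rightarrow> 'a::euclidean_space) \<Rightarrow> real ^ 'n \<Rightarrow> 'a \<Rightarrow> 'n \<Rightarrow> bool" where
  "asymmetric_facet \<eta> \<kappa> H i \<equiv> \<not> symmetric_facet \<eta> \<kappa> H i"

definition affine_map_with_linear_part ::
  "('a::euclidean_space \<Rightarrow> 'a) \<Rightarrow> ('a \<Rightarrow> 'a) \<Rightarrow> bool" where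
  "affine_map_with_linear_part a L \<longleftrightarrow> linear L \<and> (\<exists>b. \<forall>x. a x = L x + b)"

definition symmetry_of :: "'a::euclidean_space set \<Rightarrow> ('a \<Rightarrow> 'a) \<Rightarrow> bool" where
  "symmetry_of P a \<longleftrightarrow> (\<exists>L. affine_map_with_linear_part a L) \<and> a ` P = P"

text \<open>
  The linear map \<open>L\<close> is a robust symmetry, realised on the polytope with support numbers \<open>\<kappa>'\<close> by
  the symmetry \<open>a \<kappa>'\<close>.
\<close>

definition robust_symmetry_via ::
  "('n::finite \<Rightarrow> 'a::euclidean_space) \<Rightarrow> real ^ 'n \<Rightarrow> ('a \<Rightarrow> 'a) \<Rightarrow> (real ^ 'n \<Rightarrow> 'a \<Rightarrow> 'a) \<Rightarrow> bool"
where
  "robust_symmetry_via \<eta> \<kappa> L a \<longleftrightarrow>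
     linear L \<and>
     (\<forall>\<kappa>' \<in> chamber \<eta> \<kappa>.
        symmetry_of (polytope_of \<eta> \<kappa>') (a \<kappa>') \<and> affine_map_with_linear_part (a \<kappa>') L)"

definition robust_symmetry ::
  "('n::finite \<Rightarrow> 'a::euclidean_space) \<Rightarrow> real ^ 'n \<Rightarrow> ('a \<Rightarrow> 'a) \<Rightarrow> bool" where
  "robust_symmetry \<eta> \<kappa> L \<longleftrightarrow> (\<exists>a. robust_symmetry_via \<eta> \<kappa> L a)"

definition equivalent_facets ::
  "('n::finite \<Rightarrow> 'a::euclidean_space) \<Rightarrow> real ^ 'n \<Rightarrow> 'n \<Rightarrow> 'n \<Rightarrow> bool" where
  "equivalent_facets \<eta> \<kappa> i j \<longleftrightarrow>
     (\<exists>L a. robust_symmetry_via \<eta> \<kappa> L a \<and>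
        (\<forall>\<kappa>' \<in> chamber \<eta> \<kappa>. a \<kappa>' ` facet \<eta> \<kappa>' i = facet \<eta> \<kappa>' j))"

definition facet_classes ::
  "('n::finite \<Rightarrow> 'a::euclidean_space) \<Rightarrow> real ^ 'n \<Rightarrow> 'n set set" where
  "facet_classes \<eta> \<kappa> = UNIV // {(i, j). equivalent_facets \<eta> \<kappa> i j}"

definition normalized_conormals ::
  "('n::finite \<Rightarrow> 'a::euclidean_space) \<Rightarrow> real ^ 'n \<Rightarrow> bool" where
  "normalized_conormals \<eta> \<kappa> \<longleftrightarrow>
     (\<forall>L. robust_symmetry \<eta> \<kappa> L \<longrightarrow> (\<forall>i. \<exists>j. adjoint L (\<eta> i) = \<eta> j))"

definition inessential ::
  "('n::finite \<Rightarrow> 'a::euclidean_space) \<Rightarrow> real ^ 'n \<Rightarrow> 'a \<Rightarrow> bool" where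
  "inessential \<eta> \<kappa> H \<longleftrightarrow>
     (\<exists>\<beta> :: 'n \<Rightarrow> real.
        H = (\<Sum>i\<in>UNIV. \<beta> i *\<^sub>R \<eta> i) \<and> (\<forall>I \<in> facet_classes \<eta> \<kappa>. (\<Sum>i\<in>I. \<beta> i) = 0))"

end

theory Submission
  imports Defs
begin

text \<open>
  Write \<open>F\<^sub>i\<close> for the facets, \<open>V(\<kappa>)\<close> for the volume of \<open>\<Delta>(\<kappa>)\<close> and
  \<open>\<langle>H, c(\<kappa>)\<rangle> = \<Sum>\<^sub>i \<gamma>\<^sub>i \<kappa>\<^sub>i + C\<close>.  The facet \<open>F\<^sub>i\<close> is asymmetric exactly when \<open>\<gamma>\<^sub>i \<noteq> 0\<close>.

  Suppose that \<open>F\<^sub>i\<close> is asymmetric and disjoint from \<open>F\<^sub>j\<close>.  Lowering \<open>\<kappa>\<^sub>i\<close> by \<open>s\<close> and \<open>\<kappa>\<^sub>j\<close> by \<open>r\<close> cuts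
  off two disjoint slabs, of volumes \<open>a(s)\<close> and \<open>b(r)\<close> say.  So the mixed second differences of \<open>V\<close> and of
  the moment \<open>(\<Sum>\<^sub>i \<gamma>\<^sub>i \<kappa>\<^sub>i + C) V\<close> vanish, which gives \<open>\<gamma>\<^sub>i s b(r) + \<gamma>\<^sub>j r a(s) = 0\<close>
  (\<open>slab_exchange\<close>).  This identity holds for all support numbers near \<open>\<kappa>\<close> and has three consequences:
  \<open>\<gamma>\<^sub>i\<close> and \<open>\<gamma>\<^sub>j\<close> have opposite signs (\<open>disjoint_signs\<close>); \<open>F\<^sub>i\<close> meets every facet other than \<open>F\<^sub>j\<close>
  (\<open>meets_all_others\<close>); and \<open>a(s)\<close> is proportional to \<open>s\<close> (\<open>slab_linear\<close>).

  Applied to differences in further support numbers, the last statement says that small neighbourhoods of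
  the edges of \<open>F\<^sub>i\<close> also have volume proportional to their depth.  Hence the edges of \<open>\<Delta>\<close> that leave \<open>F\<^sub>i\<close>
  at adjacent vertices of \<open>F\<^sub>i\<close> are parallel (\<open>edge_transport\<close>).  As the vertices of \<open>F\<^sub>i\<close> are connected
  by edges, there is one direction \<open>\<zeta>\<close>, transverse to \<open>F\<^sub>i\<close>, to which the conormals of all facets other than
  \<open>F\<^sub>i\<close> and \<open>F\<^sub>j\<close> are orthogonal (\<open>flat_facet\<close>).  The affine reflection along \<open>\<zeta>\<close> interchanging \<open>F\<^sub>i\<close> and
  \<open>F\<^sub>j\<close> then preserves \<open>\<Delta>(\<kappa>')\<close> for every \<open>\<kappa>'\<close>, so \<open>F\<^sub>i\<close> and \<open>F\<^sub>j\<close> are equivalent.  By the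
  normalization of the conormals the dual reflection interchanges \<open>\<eta>\<^sub>i\<close> and \<open>\<eta>\<^sub>j\<close>, and as the reflection fixes the
  center of mass, \<open>\<langle>\<eta>\<^sub>i - \<eta>\<^sub>j, c(\<kappa>')\<rangle> = \<kappa>'\<^sub>i - \<kappa>'\<^sub>j\<close> (\<open>disjoint_asymmetric_pair\<close>).

  Subtracting the inessential function \<open>\<gamma>\<^sub>i (\<eta>\<^sub>i - \<eta>\<^sub>j)\<close> from \<open>H\<close> makes \<open>F\<^sub>i\<close> symmetric, hence by the
  sign rule \<open>F\<^sub>j\<close> as well, and changes no other coefficient.  Repetition of this step removes all
  asymmetric facets that are not pervasive.
\<close>

section \<open>Vertices and rigid sets of constraints\<close>

text \<open>
  The indices of the constraints that hold with equality at \<open>x\<close>.  The definition also makes sense for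
  \<open>x\<close> outside the polytope; inside it, these are the facets through \<open>x\<close>.
\<close>

definition tight :: "('n::finite \<Rightarrow> 'a::euclidean_space) \<Rightarrow> real ^ 'n \<Rightarrow> 'a \<Rightarrow> 'n set" where
  "tight \<eta> \<kappa> x = {i. \<eta> i \<bullet> x = \<kappa> $ i}"

text \<open>
  The conormals indexed by \<open>T\<close> span: no nonzero direction is orthogonal to all of them.  A point of
  the polytope is a vertex exactly when its tight constraints are rigid.
\<close>

definition rigid :: "('n::finite \<Rightarrow> 'a::euclidean_space) \<Rightarrow> 'n set \<Rightarrow> bool" where
  "rigid \<eta> T \<longleftrightarrow> (\<forall>d. (\<forall>i\<in>T. \<eta> i \<bullet> d = 0) \<longrightarrow> d = 0)"

lemma mem_polytope_of: "x \<in> polytope_of \<eta> \<kappa> \<longleftrightarrow> (\<forall>i. \<eta> i \<bullet> x \<le> \<kappa> $ i)"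
  by (auto simp: polytope_of_def)

lemma mem_facet: "x \<in> facet \<eta> \<kappa> i \<longleftrightarrow> x \<in> polytope_of \<eta> \<kappa> \<and> i \<in> tight \<eta> \<kappa> x"
  by (auto simp: facet_def tight_def)

lemma convex_polytope_of: "convex (polytope_of \<eta> \<kappa>)"
  unfolding polytope_of_def by (intro convex_INT) (auto intro: convex_halfspace_le)

lemma closed_polytope_of: "closed (polytope_of \<eta> \<kappa>)"
  unfolding polytope_of_def by (intro closed_INT) (auto intro: closed_halfspace_le)

lemma eventually_add_small:
  fixes x d :: "'a::euclidean_space"
  shows "\<eta> \<bullet> x < (c::real) \<Longrightarrow> \<forall>\<^sub>F t in at_right 0. \<eta> \<bullet> (x + t *\<^sub>R d) < c"
    and "\<eta> \<bullet> x > c \<Longrightarrow> \<forall>\<^sub>F t in at_right 0. \<eta> \<bullet> (x + t *\<^sub>R d) > c"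
proof -
  have "((\<lambda>t. \<eta> \<bullet> (x + t *\<^sub>R d)) \<longlongrightarrow> \<eta> \<bullet> (x + 0 *\<^sub>R d)) (at_right 0)"
    by (intro tendsto_intros)
  then have *: "((\<lambda>t. \<eta> \<bullet> (x + t *\<^sub>R d)) \<longlongrightarrow> \<eta> \<bullet> x) (at_right 0)" by simp
  show "\<eta> \<bullet> x < (c::real) \<Longrightarrow> \<forall>\<^sub>F t in at_right 0. \<eta> \<bullet> (x + t *\<^sub>R d) < c"
    using order_tendstoD(2)[OF *] by auto
  show "\<eta> \<bullet> x > (c::real) \<Longrightarrow> \<forall>\<^sub>F t in at_right 0. \<eta> \<bullet> (x + t *\<^sub>R d) > c"
    using order_tendstoD(1)[OF *] by auto
qed

lemma eventually_at_right_ex: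
  assumes "eventually P (at_right (0::real))"
  shows "\<exists>t>0. P t"
proof -
  have "eventually (\<lambda>t. t > 0 \<and> P t) (at_right (0::real))"
    using assms eventually_at_right_less[of "0::real"] by eventually_elim auto
  then show ?thesis using eventually_happens by fastforce
qed

lemma extreme_point_iff_rigid:
  assumes x: "x \<in> polytope_of \<eta> \<kappa>"
  shows "x extreme_point_of polytope_of \<eta> \<kappa> \<longleftrightarrow> rigid \<eta> (tight \<eta> \<kappa> x)"
proof
  assume ext: "x extreme_point_of polytope_of \<eta> \<kappa>"
  show "rigid \<eta> (tight \<eta> \<kappa> x)" unfolding rigid_def
  proof (intro allI impI, rule ccontr)
    fix d assume d: "\<forall>i\<in>tight \<eta> \<kappa> x. \<eta> i \<bullet> d = 0" and "d \<noteq> 0"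
    have ev: "\<forall>\<^sub>F t in at_right 0. \<eta> i \<bullet> (x + t *\<^sub>R d') \<le> \<kappa> $ i" if "d' = d \<or> d' = -d" for i d'
    proof (cases "i \<in> tight \<eta> \<kappa> x")
      case True
      then show ?thesis using d that by (auto simp: tight_def inner_add_right)
    next
      case False
      then have "\<eta> i \<bullet> x < \<kappa> $ i" using x by (auto simp: tight_def mem_polytope_of order_less_le)
      from eventually_add_small(1)[OF this, of d'] show ?thesis
        by (rule eventually_mono) auto
    qed
    have "\<forall>\<^sub>F t in at_right 0. (\<forall>i. \<eta> i \<bullet> (x + t *\<^sub>R d) \<le> \<kappa> $ i) \<and> (\<forall>i. \<eta> i \<bullet> (x + t *\<^sub>R (-d)) \<le> \<kappa> $ i)"
      by (rule eventually_conj; rule eventually_all_finite; rule ev; simp)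
    then obtain t where t: "t > 0" "x + t *\<^sub>R d \<in> polytope_of \<eta> \<kappa>" "x + t *\<^sub>R (-d) \<in> polytope_of \<eta> \<kappa>"
      using eventually_at_right_ex unfolding mem_polytope_of by blast
    have "(x + t *\<^sub>R d) + (x + t *\<^sub>R (-d)) = 2 *\<^sub>R x" by (simp add: scaleR_2)
    then have "x = midpoint (x + t *\<^sub>R d) (x + t *\<^sub>R (-d))" by (simp add: midpoint_def)
    moreover have "x + t *\<^sub>R d \<noteq> x + t *\<^sub>R (-d)" 
    proof
      assume "x + t *\<^sub>R d = x + t *\<^sub>R (-d)"
      then have "d \<bullet> (t *\<^sub>R d) = d \<bullet> (t *\<^sub>R (-d))" by simp
      then show False using t(1) \<open>d \<noteq> 0\<close> by simp
    qed
    ultimately have "x \<in> open_segment (x + t *\<^sub>R d) (x + t *\<^sub>R (-d))"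
      by (metis midpoint_in_open_segment)
    then show False using ext t by (auto simp: extreme_point_of_def)
  qed
next
  assume r: "rigid \<eta> (tight \<eta> \<kappa> x)"
  show "x extreme_point_of polytope_of \<eta> \<kappa>" unfolding extreme_point_of_def
  proof (intro conjI ballI notI)
    fix a b assume ab: "a \<in> polytope_of \<eta> \<kappa>" "b \<in> polytope_of \<eta> \<kappa>" "x \<in> open_segment a b"
    from ab(3) obtain u where u: "a \<noteq> b" "0 < u" "u < 1" "x = (1 - u) *\<^sub>R a + u *\<^sub>R b"
      by (auto simp: in_segment)
    have "\<eta> i \<bullet> (a - b) = 0" if "i \<in> tight \<eta> \<kappa> x" for i
    proof -
      have le: "\<eta> i \<bullet> a \<le> \<kappa> $ i" "\<eta> i \<bullet> b \<le> \<kappa> $ i" using ab by (auto simp: mem_polytope_of)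
      have "(1 - u) * (\<eta> i \<bullet> a) + u * (\<eta> i \<bullet> b) = \<kappa> $ i"
        using that u(4) by (simp add: tight_def inner_add_right)
      then have "(1 - u) * (\<kappa> $ i - \<eta> i \<bullet> a) + u * (\<kappa> $ i - \<eta> i \<bullet> b) = 0" by (simp add: algebra_simps)
      moreover have "(1 - u) * (\<kappa> $ i - \<eta> i \<bullet> a) \<ge> 0" "u * (\<kappa> $ i - \<eta> i \<bullet> b) \<ge> 0" using le u by auto
      ultimately have "(1 - u) * (\<kappa> $ i - \<eta> i \<bullet> a) = 0" "u * (\<kappa> $ i - \<eta> i \<bullet> b) = 0" by linarith+
      then show ?thesis using u by (simp add: inner_diff_right)
    qed
    then have "a - b = 0" using r unfolding rigid_def by blast
    then show False using u by simp
  qed fact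
qed

lemma rigid_span:
  assumes "rigid \<eta> T" shows "span (\<eta> ` T) = UNIV"
proof (rule ccontr)
  assume "span (\<eta> ` T) \<noteq> UNIV"
  then obtain d where "d \<noteq> 0" "\<forall>x\<in>span (\<eta> ` T). d \<bullet> x = 0"
    using span_not_UNIV_orthogonal by blast
  then show False using assms unfolding rigid_def
    by (metis imageI inner_commute span_base)
qed

lemma rigid_mono: "rigid \<eta> T \<Longrightarrow> T \<subseteq> T' \<Longrightarrow> rigid \<eta> T'"
  by (auto simp: rigid_def)

lemma rigid_card:
  fixes \<eta> :: "'n::finite \<Rightarrow> 'a::euclidean_space"
  assumes "rigid \<eta> T" shows "DIM('a) \<le> card T"
proof -
  have "dim (UNIV :: 'a set) \<le> card (\<eta> ` T)"
    by (rule dim_le_card) (use rigid_span[OF assms] in auto)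
  also have "\<dots> \<le> card T" by (rule card_image_le) auto
  finally show ?thesis by simp
qed

lemma rigid_basis:
  fixes \<eta> :: "'n::finite \<Rightarrow> 'a::euclidean_space"
  assumes r: "rigid \<eta> T" and c: "card T = DIM('a)"
  shows "inj_on \<eta> T" "independent (\<eta> ` T)"
proof -
  have "dim (UNIV :: 'a set) \<le> card (\<eta> ` T)"
    by (rule dim_le_card) (use rigid_span[OF r] in auto)
  moreover have le: "card (\<eta> ` T) \<le> card T" by (rule card_image_le) auto
  ultimately have e: "card (\<eta> ` T) = DIM('a)" using c by simp
  show "inj_on \<eta> T" by (rule eq_card_imp_inj_on) (use e c in auto)
  show "independent (\<eta> ` T)"
    by (rule card_le_dim_spanning[of _ UNIV]) (use e rigid_span[OF r] in auto)
qed

text \<open>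
  At a vertex of a simple polytope the tight conormals form a basis, so a direction may be prescribed
  by its pairings with them.
\<close>

lemma rigid_dual:
  fixes \<eta> :: "'n::finite \<Rightarrow> 'a::euclidean_space"
  assumes r: "rigid \<eta> T" and c: "card T = DIM('a)"
  obtains d where "\<And>i. i \<in> T \<Longrightarrow> \<eta> i \<bullet> d = g i"
proof -
  note b = rigid_basis[OF assms]
  obtain h where h: "linear h" "\<forall>x\<in>\<eta> ` T. h x = g (inv_into T \<eta> x)"
    using linear_independent_extend[OF b(2), of "\<lambda>x. g (inv_into T \<eta> x)"] by auto
  have "\<eta> i \<bullet> adjoint h 1 = g i" if "i \<in> T" for i
    using h that b(1) adjoint_works[OF h(1), of "\<eta> i" 1] by (auto simp: inv_into_f_f)
  then show ?thesis using that by blast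
qed

lemma rigid_expand:
  fixes \<eta> :: "'n::finite \<Rightarrow> 'a::euclidean_space"
  assumes r: "rigid \<eta> T" and c: "card T = DIM('a)"
  obtains c where "y = (\<Sum>k\<in>T. c k *\<^sub>R \<eta> k)"
proof -
  have "y \<in> span (\<eta> ` T)" using rigid_span[OF r] by auto
  then obtain u where "y = (\<Sum>x\<in>\<eta> ` T. u x *\<^sub>R x)" 
    by (auto simp: span_finite)
  then show ?thesis using that[of "\<lambda>k. u (\<eta> k)"] by (simp add: sum.reindex[OF rigid_basis(1)[OF assms]])
qed

section \<open>Interior points, boundedness and faces\<close>

lemma simpleD:
  fixes \<eta> :: "'n::finite \<Rightarrow> 'a::euclidean_space"
  assumes "simple_polytope \<eta> \<kappa>" "x \<in> polytope_of \<eta> \<kappa>" "rigid \<eta> (tight \<eta> \<kappa> x)"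
  shows "card (tight \<eta> \<kappa> x) = DIM('a)"
proof -
  have "{i. x \<in> facet \<eta> \<kappa> i} = tight \<eta> \<kappa> x" using assms(2) by (auto simp: mem_facet)
  then show ?thesis using assms extreme_point_iff_rigid[OF assms(2)] by (auto simp: simple_polytope_def)
qed

lemma conormal_nonzero:
  fixes \<eta> :: "'n::finite \<Rightarrow> 'a::euclidean_space"
  assumes "is_polytope \<eta> \<kappa>" shows "\<eta> i \<noteq> 0"
proof
  assume z: "\<eta> i = 0"
  have a: "aff_dim (facet \<eta> \<kappa> i) = int DIM('a) - 1" using assms by (auto simp: is_polytope_def)
  have u: "aff_dim (polytope_of \<eta> \<kappa>) = int DIM('a)"
    using assms by (auto simp: is_polytope_def aff_dim_eq_full)
  show False
  proof (cases "\<kappa> $ i = 0")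
    case True
    then have "facet \<eta> \<kappa> i = polytope_of \<eta> \<kappa>" using z by (auto simp: facet_def)
    then show False using a u by simp
  next
    case False
    then have "facet \<eta> \<kappa> i = {}" using z by (auto simp: facet_def)
    then show False using a by simp
  qed
qed

lemma interior_point:
  fixes \<eta> :: "'n::finite \<Rightarrow> 'a::euclidean_space"
  assumes "is_polytope \<eta> \<kappa>"
  obtains x where "\<And>i. \<eta> i \<bullet> x < \<kappa> $ i"
proof -
  have ah: "affine hull (polytope_of \<eta> \<kappa>) = UNIV" using assms by (auto simp: is_polytope_def)
  then have "polytope_of \<eta> \<kappa> \<noteq> {}" by auto
  then have "rel_interior (polytope_of \<eta> \<kappa>) \<noteq> {}"
    using rel_interior_eq_empty[OF convex_polytope_of] by auto
  then obtain x where x: "x \<in> interior (polytope_of \<eta> \<kappa>)" using rel_interior_interior[OF ah] by auto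
  have "\<eta> i \<bullet> x < \<kappa> $ i" for i
  proof -
    have "x \<in> interior {x. \<eta> i \<bullet> x \<le> \<kappa> $ i}"
      using x interior_mono[of "polytope_of \<eta> \<kappa>" "{x. \<eta> i \<bullet> x \<le> \<kappa> $ i}"] by (auto simp: polytope_of_def)
    then show ?thesis using interior_halfspace_le[OF conormal_nonzero[OF assms]] by auto
  qed
  then show ?thesis using that by blast
qed

text \<open>
  The constant \<open>c\<close> depends on the conormals only, so one bounded polytope makes all polytopes with
  the same conormals bounded, uniformly for bounded support numbers.
\<close>

lemma recession_bound:
  fixes \<eta> :: "'n::finite \<Rightarrow> 'a::euclidean_space"
  assumes "is_polytope \<eta> \<kappa>"
  obtains c where "c > 0" "\<And>x. \<exists>i. \<eta> i \<bullet> x \<ge> c * norm x"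
proof -
  obtain x0 where x0: "\<And>i. \<eta> i \<bullet> x0 < \<kappa> $ i" using interior_point[OF assms] by blast
  have "bounded (polytope_of \<eta> \<kappa>)" using assms by (auto simp: is_polytope_def)
  then obtain R where R: "R > 0" "polytope_of \<eta> \<kappa> \<subseteq> ball x0 R"
    using bounded_subset_ballD by blast
  define g where "g = Min (range (\<lambda>i. \<kappa> $ i - \<eta> i \<bullet> x0))"
  have g: "g > 0" unfolding g_def using x0 by (subst Min_gr_iff) auto
  have gle: "g \<le> \<kappa> $ i - \<eta> i \<bullet> x0" for i unfolding g_def by (rule Min_le) auto
  have "\<exists>i. \<eta> i \<bullet> x \<ge> g / R * norm x" for x
  proof (cases "x = 0")
    case False
    define d where "d = x /\<^sub>R norm x"
    have d: "norm d = 1" using False by (simp add: d_def)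
    have "dist x0 (x0 + R *\<^sub>R d) = R" using d R(1) by (simp add: dist_norm)
    then have "x0 + R *\<^sub>R d \<notin> polytope_of \<eta> \<kappa>" using R(2) by fastforce
    then obtain i where "\<eta> i \<bullet> (x0 + R *\<^sub>R d) > \<kappa> $ i" by (auto simp: mem_polytope_of not_le)
    then have "R * (\<eta> i \<bullet> d) > g" using gle[of i] by (simp add: inner_add_right)
    then have "\<eta> i \<bullet> d \<ge> g / R" using R(1) by (simp add: field_simps)
    then have "\<eta> i \<bullet> x \<ge> g / R * norm x" using False by (simp add: d_def divide_simps)
    then show ?thesis by blast
  qed auto
  then show ?thesis using that[of "g / R"] g R(1) by auto
qed

lemma no_recession:
  assumes "is_polytope \<eta> \<kappa>" "\<And>i. \<eta> i \<bullet> d \<le> 0" shows "d = 0"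
proof -
  obtain c where c: "c > 0" "\<And>x. \<exists>i. \<eta> i \<bullet> x \<ge> c * norm x" using recession_bound[OF assms(1)] by blast
  obtain i where "\<eta> i \<bullet> d \<ge> c * norm d" using c(2) by blast
  then have "c * norm d \<le> 0" using assms(2)[of i] by linarith
  then show ?thesis using c(1) by (simp add: mult_le_0_iff)
qed

text \<open>
  Nonemptiness of a prescribed face is a closed condition on the support numbers.  The openness of
  simplicity and the stability of disjointness of two facets both follow from this.
\<close>

lemma closed_tight_feasible:
  fixes \<eta> :: "'n::finite \<Rightarrow> 'a::euclidean_space"
  assumes "is_polytope \<eta> \<kappa>"
  shows "closed {\<kappa>'. \<exists>x\<in>polytope_of \<eta> \<kappa>'. T \<subseteq> tight \<eta> \<kappa>' x}"
proof -
  obtain c where c: "c > 0" "\<And>x. \<exists>i. \<eta> i \<bullet> x \<ge> c * norm x" using recession_bound[OF assms] by blast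
  show ?thesis unfolding closed_sequential_limits
  proof (intro allI impI, elim conjE)
    fix k l assume k: "\<forall>n. k n \<in> {\<kappa>'. \<exists>x\<in>polytope_of \<eta> \<kappa>'. T \<subseteq> tight \<eta> \<kappa>' x}" and lim: "k \<longlonglongrightarrow> l"
    then obtain x where x: "\<And>n. x n \<in> polytope_of \<eta> (k n)" "\<And>n. T \<subseteq> tight \<eta> (k n) (x n)"
      by simp metis
    have "Bseq k" using lim by (metis convergent_def convergent_imp_Bseq)
    then obtain B where B: "\<And>n. norm (k n) \<le> B" by (auto simp: Bseq_def)
    have "norm (x n) \<le> B / c" for n
    proof -
      obtain i where "c * norm (x n) \<le> \<eta> i \<bullet> x n" using c(2) by blast
      also have "\<dots> \<le> k n $ i" using x(1) by (auto simp: mem_polytope_of)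
      also have "\<dots> \<le> B" using B[of n] component_le_norm_cart[of "k n" i] by linarith
      finally show ?thesis using c(1) by (simp add: field_simps)
    qed
    then have "\<forall>n. x n \<in> cball 0 (B / c)" by simp
    then obtain y r where yr: "strict_mono (r::nat\<Rightarrow>nat)" "(x \<circ> r) \<longlonglongrightarrow> y"
      using compact_cball[of "0::'a" "B/c"] unfolding compact_def by blast
    have kr: "(\<lambda>n. k (r n)) \<longlonglongrightarrow> l" using LIMSEQ_subseq_LIMSEQ[OF lim yr(1)] by (simp add: o_def)
    have t1: "(\<lambda>n. \<eta> i \<bullet> x (r n)) \<longlonglongrightarrow> \<eta> i \<bullet> y" for i
      using yr(2) by (intro tendsto_intros) (simp add: o_def)
    have t2: "(\<lambda>n. k (r n) $ i) \<longlonglongrightarrow> l $ i" for i by (intro tendsto_intros kr)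
    have "y \<in> polytope_of \<eta> l" unfolding mem_polytope_of
      using LIMSEQ_le[OF t1 t2] x(1) by (auto simp: mem_polytope_of)
    moreover have "\<eta> i \<bullet> y = l $ i" if "i \<in> T" for i
    proof -
      have "(\<lambda>n. \<eta> i \<bullet> x (r n)) = (\<lambda>n. k (r n) $ i)" using x(2) that by (force simp: tight_def)
      then show ?thesis using t1[of i] t2[of i] LIMSEQ_unique by metis
    qed
    ultimately show "l \<in> {\<kappa>'. \<exists>x\<in>polytope_of \<eta> \<kappa>'. T \<subseteq> tight \<eta> \<kappa>' x}" by (auto simp: tight_def)
  qed
qed

lemma compact_polytope_of: "is_polytope \<eta> \<kappa> \<Longrightarrow> compact (polytope_of \<eta> \<kappa>)"
  using closed_polytope_of by (auto simp: compact_eq_bounded_closed is_polytope_def)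

lemma face_vertex:
  assumes P: "is_polytope \<eta> \<kappa>" and x: "x \<in> polytope_of \<eta> \<kappa>" "T \<subseteq> tight \<eta> \<kappa> x"
  obtains v where "v \<in> polytope_of \<eta> \<kappa>" "rigid \<eta> (tight \<eta> \<kappa> v)" "T \<subseteq> tight \<eta> \<kappa> v"
proof -
  let ?F = "polytope_of \<eta> \<kappa> \<inter> (\<Inter>i\<in>T. {y. \<eta> i \<bullet> y = \<kappa> $ i})"
  have face: "?F face_of polytope_of \<eta> \<kappa>"
  proof (cases "T = {}")
    case False
    have eq: "?F = (\<Inter>i\<in>T. polytope_of \<eta> \<kappa> \<inter> {y. \<eta> i \<bullet> y = \<kappa> $ i})" using False by auto
    show ?thesis unfolding eq
    proof (rule face_of_Inter)
      fix F assume "F \<in> (\<lambda>i. polytope_of \<eta> \<kappa> \<inter> {y. \<eta> i \<bullet> y = \<kappa> $ i}) ` T"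
      then obtain i where F: "F = polytope_of \<eta> \<kappa> \<inter> {y. \<eta> i \<bullet> y = \<kappa> $ i}" by blast
      show "F face_of polytope_of \<eta> \<kappa>" unfolding F
        by (rule face_of_Int_supporting_hyperplane_le[OF convex_polytope_of]) (simp add: mem_polytope_of)
    qed (use False in simp)
  qed (simp add: face_of_refl convex_polytope_of)
  have "compact ?F"
    by (intro compact_Int_closed compact_polytope_of P closed_INT ballI closed_hyperplane)
  moreover have "convex ?F"
    by (intro convex_Int convex_polytope_of convex_INT convex_hyperplane)
  moreover have "?F \<noteq> {}" using x by (auto simp: tight_def)
  ultimately obtain v where "v extreme_point_of ?F" by (rule extreme_point_exists_convex)
  then have "v extreme_point_of polytope_of \<eta> \<kappa>" "v \<in> ?F"
    using extreme_point_of_face[OF face] by blast+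
  then have "v \<in> polytope_of \<eta> \<kappa>" "rigid \<eta> (tight \<eta> \<kappa> v)" "T \<subseteq> tight \<eta> \<kappa> v"
    using extreme_point_iff_rigid[of v \<eta> \<kappa>] by (auto simp: tight_def)
  then show ?thesis by (rule that)
qed

lemma facet_nonempty:
  fixes \<eta> :: "'n::finite \<Rightarrow> 'a::euclidean_space"
  assumes "is_polytope \<eta> \<kappa>" shows "facet \<eta> \<kappa> i \<noteq> {}"
proof -
  have "aff_dim (facet \<eta> \<kappa> i) = int DIM('a) - 1" using assms by (auto simp: is_polytope_def)
  then have "aff_dim (facet \<eta> \<kappa> i) \<noteq> -1" by simp
  then show ?thesis by (metis aff_dim_empty)
qed

lemma facet_interior_point:
  fixes \<eta> :: "'n::finite \<Rightarrow> 'a::euclidean_space"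
  assumes "simple_polytope \<eta> \<kappa>"
  obtains x where "\<eta> i \<bullet> x = \<kappa> $ i" "\<And>j. j \<noteq> i \<Longrightarrow> \<eta> j \<bullet> x < \<kappa> $ j"
proof -
  have P: "is_polytope \<eta> \<kappa>" using assms by (auto simp: simple_polytope_def)
  obtain y where y: "y \<in> facet \<eta> \<kappa> i" using facet_nonempty[OF P] by blast
  then have "y \<in> polytope_of \<eta> \<kappa>" "{i} \<subseteq> tight \<eta> \<kappa> y" by (auto simp: mem_facet)
  then obtain v where v: "v \<in> polytope_of \<eta> \<kappa>" "rigid \<eta> (tight \<eta> \<kappa> v)" "{i} \<subseteq> tight \<eta> \<kappa> v"
    by (rule face_vertex[OF P])
  obtain d where d: "\<And>j. j \<in> tight \<eta> \<kappa> v \<Longrightarrow> \<eta> j \<bullet> d = (if j = i then 0 else -1)"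
    using rigid_dual[OF v(2) simpleD[OF assms v(1,2)], of "\<lambda>j. if j = i then 0 else -1"] by blast
  have "\<forall>\<^sub>F t in at_right 0. j \<noteq> i \<longrightarrow> \<eta> j \<bullet> (v + t *\<^sub>R d) < \<kappa> $ j" for j
  proof (cases "j \<in> tight \<eta> \<kappa> v \<or> j = i")
    case True
    have "\<forall>\<^sub>F t in at_right (0::real). 0 < t" by (rule eventually_at_right_less)
    then show ?thesis
      by (rule eventually_mono) (use True d[of j] in \<open>auto simp: tight_def inner_add_right\<close>)
  next
    case False
    then have "\<eta> j \<bullet> v < \<kappa> $ j" using v(1) by (auto simp: tight_def mem_polytope_of order_less_le)
    from eventually_add_small(1)[OF this, of d] show ?thesis by (rule eventually_mono) simp
  qed
  then have "\<forall>\<^sub>F t in at_right 0. \<forall>j. j \<noteq> i \<longrightarrow> \<eta> j \<bullet> (v + t *\<^sub>R d) < \<kappa> $ j"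
    by (rule eventually_all_finite)
  then obtain t where "\<forall>j. j \<noteq> i \<longrightarrow> \<eta> j \<bullet> (v + t *\<^sub>R d) < \<kappa> $ j"
    using eventually_at_right_ex by blast
  moreover have "\<eta> i \<bullet> (v + t *\<^sub>R d) = \<kappa> $ i" using v(3) d[of i] by (auto simp: tight_def inner_add_right)
  ultimately show ?thesis using that by blast
qed

lemma aff_dim_facet:
  fixes \<eta> :: "'n::finite \<Rightarrow> 'a::euclidean_space"
  assumes nz: "\<eta> i \<noteq> 0" and x: "\<eta> i \<bullet> x = \<kappa> $ i" "\<And>j. j \<noteq> i \<Longrightarrow> \<eta> j \<bullet> x < \<kappa> $ j"
  shows "aff_dim (facet \<eta> \<kappa> i) = int DIM('a) - 1"
proof -
  let ?U = "\<Inter>j\<in>-{i}. {y. \<eta> j \<bullet> y < \<kappa> $ j}" and ?H = "{y. \<eta> i \<bullet> y = \<kappa> $ i}"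
  have "open ?U" by (intro open_INT) (auto intro: open_halfspace_lt)
  moreover have "affine ?H" by (rule affine_hyperplane)
  moreover have "?H \<inter> ?U \<noteq> {}" using x by auto
  ultimately have "aff_dim (?H \<inter> ?U) = aff_dim ?H"
    by (intro aff_dim_convex_Int_open convex_hyperplane)
  also have "\<dots> = int DIM('a) - 1" using nz by (simp add: aff_dim_hyperplane)
  finally have 1: "aff_dim (?H \<inter> ?U) = int DIM('a) - 1" .
  have "?H \<inter> ?U \<subseteq> facet \<eta> \<kappa> i"
  proof
    fix y assume y: "y \<in> ?H \<inter> ?U"
    then have "\<eta> j \<bullet> y \<le> \<kappa> $ j" for j by (cases "j = i") (auto intro: less_imp_le)
    then show "y \<in> facet \<eta> \<kappa> i" using y by (auto simp: facet_def mem_polytope_of)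
  qed
  from aff_dim_subset[OF this] 1 have "aff_dim (facet \<eta> \<kappa> i) \<ge> int DIM('a) - 1" by simp
  moreover have "aff_dim (facet \<eta> \<kappa> i) \<le> aff_dim ?H" by (rule aff_dim_subset) (auto simp: facet_def)
  ultimately show ?thesis using nz by (simp add: aff_dim_hyperplane)
qed

section \<open>Varying the support numbers\<close>

text \<open>
  Near \<open>\<kappa>\<close>, an interior point and a relative interior point of each facet survive, and no point acquires
  a rigid set of tight constraints with more than \<open>DIM('a)\<close> elements, there being finitely many such sets.
\<close>

lemma open_simple:
  fixes \<eta> :: "'n::finite \<Rightarrow> 'a::euclidean_space"
  assumes S: "simple_polytope \<eta> \<kappa>"
  shows "\<forall>\<^sub>F \<kappa>' in nhds \<kappa>. simple_polytope \<eta> \<kappa>'"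
proof -
  have P: "is_polytope \<eta> \<kappa>" using assms by (auto simp: simple_polytope_def)
  obtain c where c: "c > 0" "\<And>x. \<exists>i. \<eta> i \<bullet> x \<ge> c * norm x" using recession_bound[OF P] by blast
  obtain x0 where x0: "\<And>i. \<eta> i \<bullet> x0 < \<kappa> $ i" using interior_point[OF P] by blast
  obtain X where X: "\<And>i. \<eta> i \<bullet> X i = \<kappa> $ i" "\<And>i j. j \<noteq> i \<Longrightarrow> \<eta> j \<bullet> X i < \<kappa> $ j"
  proof -
    have "\<forall>i. \<exists>x. \<eta> i \<bullet> x = \<kappa> $ i \<and> (\<forall>j. j \<noteq> i \<longrightarrow> \<eta> j \<bullet> x < \<kappa> $ j)"
    proof
      fix i show "\<exists>x. \<eta> i \<bullet> x = \<kappa> $ i \<and> (\<forall>j. j \<noteq> i \<longrightarrow> \<eta> j \<bullet> x < \<kappa> $ j)"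
        by (rule facet_interior_point[OF S, of i]) blast
    qed
    then obtain X where "\<forall>i. \<eta> i \<bullet> X i = \<kappa> $ i \<and> (\<forall>j. j \<noteq> i \<longrightarrow> \<eta> j \<bullet> X i < \<kappa> $ j)"
      by (rule choice[THEN exE])
    then show ?thesis using that by blast
  qed
  define Y where "Y = (\<lambda>\<kappa>' :: real^'n. \<lambda>i. X i + ((\<kappa>' $ i - \<kappa> $ i) / (\<eta> i \<bullet> \<eta> i)) *\<^sub>R \<eta> i)"
  have Y1: "\<eta> i \<bullet> Y \<kappa>' i = \<kappa>' $ i" for \<kappa>' i
    using conormal_nonzero[OF P, of i] X(1)[of i] by (simp add: Y_def inner_add_right)
  let ?Bad = "{T. rigid \<eta> T \<and> card T \<noteq> DIM('a)}"
  have id: "((\<lambda>\<kappa>'. \<kappa>') \<longlongrightarrow> \<kappa>) (nhds \<kappa>)" by (simp add: filterlim_def)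
  have "\<forall>\<^sub>F \<kappa>' in nhds \<kappa>. \<forall>i. \<eta> i \<bullet> x0 < \<kappa>' $ i"
  proof (rule eventually_all_finite)
    fix i show "\<forall>\<^sub>F \<kappa>' in nhds \<kappa>. \<eta> i \<bullet> x0 < \<kappa>' $ i"
      by (rule order_tendstoD(1)[OF tendsto_vec_nth[OF id] x0])
  qed
  moreover have "\<forall>\<^sub>F \<kappa>' in nhds \<kappa>. \<forall>i j. j \<noteq> i \<longrightarrow> \<eta> j \<bullet> Y \<kappa>' i < \<kappa>' $ j"
  proof (rule eventually_all_finite, rule eventually_all_finite)
    fix i j
    have "((\<lambda>\<kappa>'. \<kappa>' $ j - \<eta> j \<bullet> Y \<kappa>' i) \<longlongrightarrow> \<kappa> $ j - \<eta> j \<bullet> (X i + ((\<kappa> $ i - \<kappa> $ i) / (\<eta> i \<bullet> \<eta> i)) *\<^sub>R \<eta> i)) (nhds \<kappa>)"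
      unfolding Y_def by (intro tendsto_intros id) (use conormal_nonzero[OF P, of i] in auto)
    then have lim: "((\<lambda>\<kappa>'. \<kappa>' $ j - \<eta> j \<bullet> Y \<kappa>' i) \<longlongrightarrow> \<kappa> $ j - \<eta> j \<bullet> X i) (nhds \<kappa>)" by simp
    show "\<forall>\<^sub>F \<kappa>' in nhds \<kappa>. j \<noteq> i \<longrightarrow> \<eta> j \<bullet> Y \<kappa>' i < \<kappa>' $ j"
    proof (cases "j = i")
      case False
      then have "\<forall>\<^sub>F \<kappa>' in nhds \<kappa>. 0 < \<kappa>' $ j - \<eta> j \<bullet> Y \<kappa>' i"
        using order_tendstoD(1)[OF lim, of 0] X(2)[of j i] by simp
      then show ?thesis by (rule eventually_mono) simp
    qed simp
  qed
  moreover have "\<forall>\<^sub>F \<kappa>' in nhds \<kappa>. \<forall>T\<in>?Bad. \<not> (\<exists>x\<in>polytope_of \<eta> \<kappa>'. T \<subseteq> tight \<eta> \<kappa>' x)"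
  proof (rule eventually_ball_finite, simp, intro ballI)
    fix T assume T: "T \<in> ?Bad"
    have "open (- {\<kappa>'. \<exists>x\<in>polytope_of \<eta> \<kappa>'. T \<subseteq> tight \<eta> \<kappa>' x})"
      using closed_tight_feasible[OF P] by (rule open_Compl)
    moreover have "\<kappa> \<in> - {\<kappa>'. \<exists>x\<in>polytope_of \<eta> \<kappa>'. T \<subseteq> tight \<eta> \<kappa>' x}"
    proof (rule ccontr)
      assume "\<not> ?thesis"
      then obtain x where x: "x \<in> polytope_of \<eta> \<kappa>" "T \<subseteq> tight \<eta> \<kappa> x" by auto
      have "rigid \<eta> (tight \<eta> \<kappa> x)" using T x(2) rigid_mono by auto
      from simpleD[OF S x(1) this] have "card T \<le> DIM('a)" using x(2) card_mono[OF _ x(2)] by auto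
      then show False using T rigid_card[of \<eta> T] by auto
    qed
    ultimately show "\<forall>\<^sub>F \<kappa>' in nhds \<kappa>. \<not> (\<exists>x\<in>polytope_of \<eta> \<kappa>'. T \<subseteq> tight \<eta> \<kappa>' x)"
      unfolding eventually_nhds by blast
  qed
  ultimately show ?thesis
  proof eventually_elim
    case (elim \<kappa>')
    have b: "bounded (polytope_of \<eta> \<kappa>')" unfolding bounded_iff
    proof (intro exI ballI)
      fix x assume x: "x \<in> polytope_of \<eta> \<kappa>'"
      obtain i where "c * norm x \<le> \<eta> i \<bullet> x" using c(2) by blast
      also have "\<dots> \<le> \<kappa>' $ i" using x by (auto simp: mem_polytope_of)
      also have "\<dots> \<le> norm \<kappa>'" using component_le_norm_cart[of \<kappa>' i] by linarith
      finally show "norm x \<le> norm \<kappa>' / c" using c(1) by (simp add: field_simps)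
    qed
    have "(\<Inter>i. {x. \<eta> i \<bullet> x < \<kappa>' $ i}) \<subseteq> interior (polytope_of \<eta> \<kappa>')"
    proof (rule interior_maximal)
      show "(\<Inter>i. {x. \<eta> i \<bullet> x < \<kappa>' $ i}) \<subseteq> polytope_of \<eta> \<kappa>'"
        by (auto simp: mem_polytope_of less_imp_le)
      show "open (\<Inter>i. {x. \<eta> i \<bullet> x < \<kappa>' $ i})" by (intro open_INT ballI open_halfspace_lt finite)
    qed
    moreover have "x0 \<in> (\<Inter>i. {x. \<eta> i \<bullet> x < \<kappa>' $ i})" using elim(1) by simp
    ultimately have "x0 \<in> interior (polytope_of \<eta> \<kappa>')" by (rule subsetD)
    then have "interior (polytope_of \<eta> \<kappa>') \<noteq> {}" by blast
    then have a: "affine hull (polytope_of \<eta> \<kappa>') = UNIV" by (rule affine_hull_nonempty_interior)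
    have f: "aff_dim (facet \<eta> \<kappa>' i) = int DIM('a) - 1" for i
      by (rule aff_dim_facet[OF conormal_nonzero[OF P], where x = "Y \<kappa>' i"]) (rule Y1, use elim(2) in simp)
    have "card {i. v \<in> facet \<eta> \<kappa>' i} = DIM('a)" if "v extreme_point_of polytope_of \<eta> \<kappa>'" for v
    proof -
      have v: "v \<in> polytope_of \<eta> \<kappa>'" using that by (auto simp: extreme_point_of_def)
      then have "{i. v \<in> facet \<eta> \<kappa>' i} = tight \<eta> \<kappa>' v" by (auto simp: mem_facet)
      moreover have "rigid \<eta> (tight \<eta> \<kappa>' v)" using that extreme_point_iff_rigid[OF v] by auto
      ultimately show ?thesis using elim(3) v by auto
    qed
    then show ?case unfolding simple_polytope_def is_polytope_def using a b f by blast
  qed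
qed

lemma nhds_box:
  fixes \<kappa> :: "real ^ 'n::finite"
  assumes "\<forall>\<^sub>F \<kappa>' in nhds \<kappa>. Q \<kappa>'"
  obtains \<epsilon> where "\<epsilon> > 0" "\<And>\<kappa>'. (\<And>k. \<bar>\<kappa>' $ k - \<kappa> $ k\<bar> \<le> \<epsilon>) \<Longrightarrow> Q \<kappa>'"
proof -
  obtain d where d: "d > 0" "\<And>\<kappa>'. dist \<kappa>' \<kappa> < d \<Longrightarrow> Q \<kappa>'"
    using assms unfolding eventually_nhds_metric by auto
  define \<epsilon> where "\<epsilon> = d / (2 * real CARD('n))"
  have "\<epsilon> > 0" using d by (simp add: \<epsilon>_def)
  moreover have "Q \<kappa>'" if "\<And>k. \<bar>\<kappa>' $ k - \<kappa> $ k\<bar> \<le> \<epsilon>" for \<kappa>'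
  proof (rule d(2))
    have "dist \<kappa>' \<kappa> \<le> (\<Sum>k\<in>UNIV. \<bar>(\<kappa>' - \<kappa>) $ k\<bar>)" unfolding dist_norm by (rule norm_le_l1_cart)
    also have "\<dots> \<le> (\<Sum>k\<in>(UNIV::'n set). \<epsilon>)" by (rule sum_mono) (use that in simp)
    also have "\<dots> = d / 2" by (simp add: \<epsilon>_def)
    finally show "dist \<kappa>' \<kappa> < d" using d(1) by simp
  qed
  ultimately show ?thesis using that by blast
qed

lemma chamber_near:
  assumes S: "simple_polytope \<eta> \<kappa>"
  shows "\<forall>\<^sub>F \<kappa>' in nhds \<kappa>. \<kappa>' \<in> chamber \<eta> \<kappa>"
proof -
  obtain d where d: "d > 0" "\<And>\<kappa>'. dist \<kappa>' \<kappa> < d \<Longrightarrow> simple_polytope \<eta> \<kappa>'"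
    using open_simple[OF S] unfolding eventually_nhds_metric by auto
  have "ball \<kappa> d \<subseteq> chamber \<eta> \<kappa>" unfolding chamber_def
    by (rule connected_component_maximal) (use d in \<open>auto simp: dist_commute\<close>)
  then show ?thesis unfolding eventually_nhds_metric using d(1) by (auto simp: dist_commute subset_iff)
qed

lemma chamber_simple: "\<kappa>' \<in> chamber \<eta> \<kappa> \<Longrightarrow> simple_polytope \<eta> \<kappa>'"
  unfolding chamber_def using connected_component_subset by blast

lemma disjoint_near:
  assumes P: "is_polytope \<eta> \<kappa>" and e: "facet \<eta> \<kappa> p \<inter> facet \<eta> \<kappa> q = {}"
  shows "\<forall>\<^sub>F \<kappa>' in nhds \<kappa>. facet \<eta> \<kappa>' p \<inter> facet \<eta> \<kappa>' q = {}"
proof -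
  let ?A = "{\<kappa>'. \<exists>x\<in>polytope_of \<eta> \<kappa>'. {p, q} \<subseteq> tight \<eta> \<kappa>' x}"
  have eq: "\<kappa>' \<in> - ?A \<longleftrightarrow> facet \<eta> \<kappa>' p \<inter> facet \<eta> \<kappa>' q = {}" for \<kappa>'
    by (auto simp: mem_facet)
  have "open (- ?A)" using closed_tight_feasible[OF P] by (rule open_Compl)
  then show ?thesis unfolding eventually_nhds using e eq by blast
qed

section \<open>Volumes and moments of slabs\<close>

abbreviation vol :: "('n::finite \<Rightarrow> 'a::euclidean_space) \<Rightarrow> real ^ 'n \<Rightarrow> real" where
  "vol \<eta> \<kappa> \<equiv> measure lebesgue (polytope_of \<eta> \<kappa>)"

lemma dec_nth [simp]: "(\<kappa> - s *\<^sub>R axis i (1::real)) $ k = \<kappa> $ k - (if k = i then s else 0)"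
  by (simp add: axis_def)

lemma polytope_dec_iff:
  assumes "0 \<le> s"
  shows "x \<in> polytope_of \<eta> (\<kappa> - s *\<^sub>R axis i 1) \<longleftrightarrow> x \<in> polytope_of \<eta> \<kappa> \<and> \<eta> i \<bullet> x \<le> \<kappa> $ i - s"
  unfolding mem_polytope_of dec_nth
proof (intro iffI conjI allI)
  fix k assume a: "\<forall>k. \<eta> k \<bullet> x \<le> \<kappa> $ k - (if k = i then s else 0)"
  show "\<eta> k \<bullet> x \<le> \<kappa> $ k" using a[rule_format, of k] assms by (auto split: if_splits)
qed (auto split: if_splits)

lemma polytope_dec_subset:
  "0 \<le> s \<Longrightarrow> polytope_of \<eta> (\<kappa> - s *\<^sub>R axis i 1) \<subseteq> polytope_of \<eta> \<kappa>"
  by (auto simp: polytope_dec_iff)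

lemma lmeasurable_polytope: "is_polytope \<eta> \<kappa> \<Longrightarrow> polytope_of \<eta> \<kappa> \<in> lmeasurable"
  by (rule lmeasurable_compact[OF compact_polytope_of])

lemma simple_is_polytope: "simple_polytope \<eta> \<kappa> \<Longrightarrow> is_polytope \<eta> \<kappa>"
  by (simp add: simple_polytope_def)

lemma open_subset_measure_pos:
  fixes U :: "'a::euclidean_space set"
  assumes "open U" "x \<in> U" "U \<subseteq> A" "A \<in> lmeasurable"
  shows "measure lebesgue A > 0"
proof (rule ccontr)
  assume "\<not> ?thesis"
  then have "measure lebesgue A = 0" by (simp add: zero_less_measure_iff)
  then have "negligible A" using assms(4) negligible_iff_measure0 by blast
  then have "negligible U" using assms(3) negligible_subset by blast
  then show False using open_not_negligible assms(1,2) by blast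
qed

lemma open_strict_region:
  fixes \<eta> :: "'n::finite \<Rightarrow> 'a::euclidean_space"
  shows "open {y. \<forall>k. a k < \<eta> k \<bullet> y \<and> \<eta> k \<bullet> y < b k}"
proof -
  have "{y. \<forall>k. a k < \<eta> k \<bullet> y \<and> \<eta> k \<bullet> y < b k} = (\<Inter>k. {y. \<eta> k \<bullet> y > a k} \<inter> {y. \<eta> k \<bullet> y < b k})"
    by auto
  also have "open \<dots>" by (intro open_INT open_Int ballI open_halfspace_lt open_halfspace_gt finite)
  finally show ?thesis .
qed

text \<open>
  A point of the polytope can be moved into the interior without lowering any \<open>\<eta> k \<bullet> x\<close> by as much
  as \<open>e\<close>.
\<close>

lemma inner_point_near:
  fixes \<eta> :: "'n::finite \<Rightarrow> 'a::euclidean_space"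
  assumes P: "is_polytope \<eta> \<kappa>" and x: "x \<in> polytope_of \<eta> \<kappa>" and e: "e > 0"
  obtains y where "\<And>k. \<eta> k \<bullet> x - e < \<eta> k \<bullet> y \<and> \<eta> k \<bullet> y < \<kappa> $ k"
proof -
  obtain x0 where x0: "\<And>i. \<eta> i \<bullet> x0 < \<kappa> $ i" using interior_point[OF P] by blast
  have A: "\<forall>\<^sub>F t in at_right 0. \<forall>k. \<eta> k \<bullet> (x + t *\<^sub>R (x0 - x)) > \<eta> k \<bullet> x - e"
    by (rule eventually_all_finite, rule eventually_add_small(2)) (use e in simp)
  have B: "\<forall>\<^sub>F t in at_right (0::real). t < 1" using eventually_at_right_real[of 0 1] by (auto elim: eventually_mono)
  obtain t where t: "t > 0" "t < 1" "\<And>k. \<eta> k \<bullet> (x + t *\<^sub>R (x0 - x)) > \<eta> k \<bullet> x - e"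
    using eventually_at_right_ex[OF eventually_conj[OF A B]] by blast
  have "\<eta> k \<bullet> (x + t *\<^sub>R (x0 - x)) < \<kappa> $ k" for k
  proof -
    have "\<eta> k \<bullet> (x + t *\<^sub>R (x0 - x)) = (1 - t) * (\<eta> k \<bullet> x) + t * (\<eta> k \<bullet> x0)"
      by (simp add: inner_add_right inner_diff_right algebra_simps)
    also have "\<dots> < (1 - t) * \<kappa> $ k + t * \<kappa> $ k"
      by (rule add_le_less_mono) (use t x x0[of k] in \<open>auto simp: mem_polytope_of mult_left_mono\<close>)
    finally show ?thesis by (simp add: algebra_simps)
  qed
  then show ?thesis using t(3) that by blast
qed

lemma corner_measure_pos:
  fixes \<eta> :: "'n::finite \<Rightarrow> 'a::euclidean_space"
  assumes P: "is_polytope \<eta> \<kappa>" and x: "x \<in> polytope_of \<eta> \<kappa>" and e: "e > 0"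
    and A: "A \<in> lmeasurable" "\<And>y. (\<And>k. \<eta> k \<bullet> x - e < \<eta> k \<bullet> y \<and> \<eta> k \<bullet> y < \<kappa> $ k) \<Longrightarrow> y \<in> A"
  shows "measure lebesgue A > 0"
proof -
  obtain y where y: "\<And>k. \<eta> k \<bullet> x - e < \<eta> k \<bullet> y \<and> \<eta> k \<bullet> y < \<kappa> $ k"
    using inner_point_near[OF P x e] by blast
  show ?thesis
    by (rule open_subset_measure_pos[OF open_strict_region[of "\<lambda>k. \<eta> k \<bullet> x - e" \<eta> "\<lambda>k. \<kappa> $ k"], of y])
       (use A y in auto)
qed

lemma vol_pos:
  assumes "is_polytope \<eta> \<kappa>" shows "vol \<eta> \<kappa> > 0"
proof -
  obtain x where "\<And>i. \<eta> i \<bullet> x < \<kappa> $ i" using interior_point[OF assms] by blast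
  then have "x \<in> polytope_of \<eta> \<kappa>" by (auto simp: mem_polytope_of less_imp_le)
  from corner_measure_pos[OF assms this zero_less_one lmeasurable_polytope[OF assms]] show ?thesis
    by (auto simp: mem_polytope_of less_imp_le)
qed

lemma integrable_polytope:
  fixes f :: "'a::euclidean_space \<Rightarrow> 'b::euclidean_space"
  assumes "is_polytope \<eta> \<kappa>" "continuous_on UNIV f"
  shows "f integrable_on polytope_of \<eta> \<kappa>"
proof -
  have "set_integrable lborel (polytope_of \<eta> \<kappa>) f" unfolding set_integrable_def
    by (rule borel_integrable_compact)
       (use assms compact_polytope_of continuous_on_subset[OF assms(2)] in auto)
  then show ?thesis by (rule set_borel_integral_eq_integral)
qed

lemma vol_diff:
  assumes "is_polytope \<eta> \<kappa>" "is_polytope \<eta> \<kappa>'" "polytope_of \<eta> \<kappa>' \<subseteq> polytope_of \<eta> \<kappa>"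
  shows "measure lebesgue (polytope_of \<eta> \<kappa> - polytope_of \<eta> \<kappa>') = vol \<eta> \<kappa> - vol \<eta> \<kappa>'"
  by (rule measurable_measure_Diff)
     (use assms lmeasurable_polytope fmeasurableD in auto)

lemma moment_diff:
  assumes "is_polytope \<eta> \<kappa>" "is_polytope \<eta> \<kappa>'" "polytope_of \<eta> \<kappa>' \<subseteq> polytope_of \<eta> \<kappa>"
  shows "integral (polytope_of \<eta> \<kappa> - polytope_of \<eta> \<kappa>') (\<lambda>x. x) =
    integral (polytope_of \<eta> \<kappa>) (\<lambda>x. x) - integral (polytope_of \<eta> \<kappa>') (\<lambda>x. x)"
proof -
  have e: "polytope_of \<eta> \<kappa>' - polytope_of \<eta> \<kappa> = {}" using assms(3) by auto
  show ?thesis by (rule integral_setdiff) (auto simp: e intro!: integrable_polytope assms)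
qed

section \<open>Consequences of mass linearity for disjoint facets\<close>

text \<open>
  The function \<open>H\<close> is mass linear with coefficients \<open>\<gamma>\<close> and constant \<open>C\<close>.
\<close>

definition mass_coeffs ::
  "('n::finite \<Rightarrow> 'a::euclidean_space) \<Rightarrow> real ^ 'n \<Rightarrow> 'a \<Rightarrow> ('n \<Rightarrow> real) \<Rightarrow> real \<Rightarrow> bool" where
  "mass_coeffs \<eta> \<kappa> H \<gamma> C \<longleftrightarrow>
     (\<forall>\<kappa>' \<in> chamber \<eta> \<kappa>. H \<bullet> center_of_mass (polytope_of \<eta> \<kappa>') = (\<Sum>i\<in>UNIV. \<gamma> i * \<kappa>' $ i) + C)"

lemma mass_moment:
  assumes "mass_coeffs \<eta> \<kappa> H \<gamma> C" "\<kappa>' \<in> chamber \<eta> \<kappa>"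
  shows "H \<bullet> integral (polytope_of \<eta> \<kappa>') (\<lambda>x. x) = ((\<Sum>i\<in>UNIV. \<gamma> i * \<kappa>' $ i) + C) * vol \<eta> \<kappa>'"
proof -
  have "vol \<eta> \<kappa>' > 0" by (rule vol_pos[OF simple_is_polytope[OF chamber_simple[OF assms(2)]]])
  moreover have "H \<bullet> center_of_mass (polytope_of \<eta> \<kappa>') = (\<Sum>i\<in>UNIV. \<gamma> i * \<kappa>' $ i) + C"
    using assms by (auto simp: mass_coeffs_def)
  ultimately show ?thesis by (simp add: center_of_mass_def field_simps)
qed

lemma sum_dec:
  "(\<Sum>k\<in>UNIV. \<gamma> k * (\<kappa> - s *\<^sub>R axis p (1::real)) $ k) = (\<Sum>k\<in>UNIV. \<gamma> k * \<kappa> $ k) - \<gamma> p * s"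
proof -
  have "(\<Sum>k\<in>UNIV. \<gamma> k * (\<kappa> - s *\<^sub>R axis p (1::real)) $ k) =
      (\<Sum>k\<in>UNIV. \<gamma> k * \<kappa> $ k - (if k = p then \<gamma> p * s else 0))"
    unfolding dec_nth by (rule sum.cong) (auto simp: algebra_simps)
  also have "\<dots> = (\<Sum>k\<in>UNIV. \<gamma> k * \<kappa> $ k) - \<gamma> p * s" by (simp add: sum_subtractf)
  finally show ?thesis .
qed

text \<open>
  The basic identity.  If \<open>F\<^sub>p\<close> and \<open>F\<^sub>q\<close> are disjoint, the slabs cut off near them are disjoint, so the
  mixed second difference in \<open>\<kappa>\<^sub>p\<close> and \<open>\<kappa>\<^sub>q\<close> of both the volume \<open>V\<close> and the moment of \<open>H\<close> vanishes.
  The moment is an affine function of \<open>\<kappa>\<close> times \<open>V\<close>; expanding the product leaves only the two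
  cross terms, each a coefficient of \<open>H\<close> times the volume of the opposite slab.
\<close>

lemma slab_exchange:
  fixes \<eta> :: "'n::finite \<Rightarrow> 'a::euclidean_space"
  assumes S: "simple_polytope \<eta> \<kappa>" and m: "mass_coeffs \<eta> \<kappa> H \<gamma> C"
    and pq: "p \<noteq> q" and d: "facet \<eta> \<kappa> p \<inter> facet \<eta> \<kappa> q = {}"
  shows "\<exists>\<epsilon>>0. \<forall>\<kappa>' s r. (\<forall>k. \<bar>\<kappa>' $ k - \<kappa> $ k\<bar> \<le> \<epsilon>) \<longrightarrow> 0 \<le> s \<longrightarrow> s \<le> \<epsilon> \<longrightarrow> 0 \<le> r \<longrightarrow> r \<le> \<epsilon> \<longrightarrow>
     polytope_of \<eta> \<kappa>' - polytope_of \<eta> (\<kappa>' - s *\<^sub>R axis p 1) =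
       polytope_of \<eta> (\<kappa>' - r *\<^sub>R axis q 1) - polytope_of \<eta> (\<kappa>' - r *\<^sub>R axis q 1 - s *\<^sub>R axis p 1) \<and>
     \<gamma> p * s * (vol \<eta> \<kappa>' - vol \<eta> (\<kappa>' - r *\<^sub>R axis q 1)) +
     \<gamma> q * r * (vol \<eta> \<kappa>' - vol \<eta> (\<kappa>' - s *\<^sub>R axis p 1)) = 0"
proof -
  obtain \<epsilon> where \<epsilon>: "\<epsilon> > 0" 
    and near: "\<And>\<kappa>'. (\<And>k. \<bar>\<kappa>' $ k - \<kappa> $ k\<bar> \<le> \<epsilon>) \<Longrightarrow> \<kappa>' \<in> chamber \<eta> \<kappa> \<and> facet \<eta> \<kappa>' p \<inter> facet \<eta> \<kappa>' q = {}"
    using nhds_box[OF eventually_conj[OF chamber_near[OF S] disjoint_near[OF simple_is_polytope[OF S] d]]]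
    by blast
  have "polytope_of \<eta> \<kappa>' - polytope_of \<eta> (\<kappa>' - s *\<^sub>R axis p 1) =
       polytope_of \<eta> (\<kappa>' - r *\<^sub>R axis q 1) - polytope_of \<eta> (\<kappa>' - r *\<^sub>R axis q 1 - s *\<^sub>R axis p 1) \<and>
     \<gamma> p * s * (vol \<eta> \<kappa>' - vol \<eta> (\<kappa>' - r *\<^sub>R axis q 1)) +
     \<gamma> q * r * (vol \<eta> \<kappa>' - vol \<eta> (\<kappa>' - s *\<^sub>R axis p 1)) = 0"
    if k': "\<And>k. \<bar>\<kappa>' $ k - \<kappa> $ k\<bar> \<le> \<epsilon>/2" and sr: "0 \<le> s" "s \<le> \<epsilon>/2" "0 \<le> r" "r \<le> \<epsilon>/2" for \<kappa>' s r
  proof -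
    let ?k00 = \<kappa>' and ?k10 = "\<kappa>' - s *\<^sub>R axis p 1" and ?k01 = "\<kappa>' - r *\<^sub>R axis q 1"
      and ?k11 = "\<kappa>' - r *\<^sub>R axis q 1 - s *\<^sub>R axis p 1"
    have shift: "\<kappa>' - r' *\<^sub>R axis q 1 - s' *\<^sub>R axis p 1 \<in> chamber \<eta> \<kappa> \<and>
       facet \<eta> (\<kappa>' - r' *\<^sub>R axis q 1 - s' *\<^sub>R axis p 1) p \<inter> facet \<eta> (\<kappa>' - r' *\<^sub>R axis q 1 - s' *\<^sub>R axis p 1) q = {}"
      if "0 \<le> s'" "s' \<le> \<epsilon>/2" "0 \<le> r'" "r' \<le> \<epsilon>/2" for s' r'
    proof (rule near)
      fix k show "\<bar>(\<kappa>' - r' *\<^sub>R axis q 1 - s' *\<^sub>R axis p 1) $ k - \<kappa> $ k\<bar> \<le> \<epsilon>"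
      proof -
        have "0 \<le> (if k = q then r' else 0) + (if k = p then s' else 0)"
          "(if k = q then r' else 0) + (if k = p then s' else 0) \<le> \<epsilon>/2" using that pq by auto
        then show ?thesis unfolding dec_nth using k'[of k] by linarith
      qed
    qed
    have ch: "?k00 \<in> chamber \<eta> \<kappa>" "?k10 \<in> chamber \<eta> \<kappa>" "?k01 \<in> chamber \<eta> \<kappa>" "?k11 \<in> chamber \<eta> \<kappa>"
      using shift[of 0 0] shift[of s 0] shift[of 0 r] shift[of s r] sr \<epsilon> by auto
    note P = ch[THEN chamber_simple, THEN simple_is_polytope]
    have no: False if "x \<in> polytope_of \<eta> \<kappa>'" "\<eta> p \<bullet> x > \<kappa>' $ p - s" "\<eta> q \<bullet> x > \<kappa>' $ q - r" for x
    proof -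
      \<comment> \<open>A common point of the two slabs lies on both facets for suitably lowered support numbers.\<close>
    let ?s = "\<kappa>' $ p - \<eta> p \<bullet> x" and ?r = "\<kappa>' $ q - \<eta> q \<bullet> x"
      have b: "0 \<le> ?s" "?s \<le> \<epsilon>/2" "0 \<le> ?r" "?r \<le> \<epsilon>/2" using that sr by (auto simp: mem_polytope_of)
      have "x \<in> polytope_of \<eta> (\<kappa>' - ?r *\<^sub>R axis q 1 - ?s *\<^sub>R axis p 1)"
        using that(1) b pq by (simp add: polytope_dec_iff del: vector_minus_component)
      then have "x \<in> facet \<eta> (\<kappa>' - ?r *\<^sub>R axis q 1 - ?s *\<^sub>R axis p 1) p \<inter> facet \<eta> (\<kappa>' - ?r *\<^sub>R axis q 1 - ?s *\<^sub>R axis p 1) q"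
        using pq by (auto simp: mem_facet tight_def simp del: vector_minus_component)
      then show False using shift[OF b] by blast
    qed
    have eq: "polytope_of \<eta> ?k00 - polytope_of \<eta> ?k10 = polytope_of \<eta> ?k01 - polytope_of \<eta> ?k11"
    proof (rule set_eqI)
      fix x
      have "x \<in> polytope_of \<eta> ?k11 \<longleftrightarrow> x \<in> polytope_of \<eta> \<kappa>' \<and> \<eta> q \<bullet> x \<le> \<kappa>' $ q - r \<and> \<eta> p \<bullet> x \<le> \<kappa>' $ p - s"
        using sr pq by (simp add: polytope_dec_iff del: vector_minus_component)
      then show "x \<in> polytope_of \<eta> ?k00 - polytope_of \<eta> ?k10 \<longleftrightarrow> x \<in> polytope_of \<eta> ?k01 - polytope_of \<eta> ?k11"
        using no[of x] sr pq
        by (cases "\<eta> q \<bullet> x \<le> \<kappa>' $ q - r") (auto simp: polytope_dec_iff not_le simp del: vector_minus_component)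
    qed
    have sub: "polytope_of \<eta> ?k10 \<subseteq> polytope_of \<eta> ?k00" "polytope_of \<eta> ?k11 \<subseteq> polytope_of \<eta> ?k01"
      using sr by (intro polytope_dec_subset; simp)+
    have V: "vol \<eta> ?k00 - vol \<eta> ?k10 = vol \<eta> ?k01 - vol \<eta> ?k11"
      using vol_diff[OF P(1,2) sub(1)] vol_diff[OF P(3,4) sub(2)] eq by simp
    have M: "H \<bullet> integral (polytope_of \<eta> ?k00) (\<lambda>x. x) - H \<bullet> integral (polytope_of \<eta> ?k10) (\<lambda>x. x) =
       H \<bullet> integral (polytope_of \<eta> ?k01) (\<lambda>x. x) - H \<bullet> integral (polytope_of \<eta> ?k11) (\<lambda>x. x)"
      using moment_diff[OF P(1,2) sub(1)] moment_diff[OF P(3,4) sub(2)] eq by (simp flip: inner_diff_right)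
    define L where "L = (\<Sum>i\<in>UNIV. \<gamma> i * \<kappa>' $ i) + C"
    have "L * vol \<eta> ?k00 - (L - \<gamma> p * s) * vol \<eta> ?k10 =
        (L - \<gamma> q * r) * vol \<eta> ?k01 - (L - \<gamma> q * r - \<gamma> p * s) * vol \<eta> ?k11"
      using M unfolding mass_moment[OF m ch(1)] mass_moment[OF m ch(2)] mass_moment[OF m ch(3)]
        mass_moment[OF m ch(4)] sum_dec L_def by (simp add: algebra_simps)
    moreover have "vol \<eta> ?k11 = vol \<eta> ?k01 - (vol \<eta> ?k00 - vol \<eta> ?k10)" using V by simp
    ultimately have "\<gamma> p * s * (vol \<eta> ?k00 - vol \<eta> ?k01) + \<gamma> q * r * (vol \<eta> ?k00 - vol \<eta> ?k10) = 0"
      by (simp only:) algebra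
    then show ?thesis using eq by blast
  qed
  then show ?thesis using \<epsilon> by (intro exI[of _ "\<epsilon>/2"]) auto
qed

text \<open>
  Lowering one support number cuts off a slab of positive volume.
\<close>

lemma slab_pos:
  assumes S: "is_polytope \<eta> \<kappa>" "is_polytope \<eta> (\<kappa> - s *\<^sub>R axis p 1)" and s: "s > 0"
  shows "vol \<eta> \<kappa> - vol \<eta> (\<kappa> - s *\<^sub>R axis p 1) > 0"
proof -
  obtain x where x: "x \<in> facet \<eta> \<kappa> p" using facet_nonempty[OF S(1)] by blast
  have "measure lebesgue (polytope_of \<eta> \<kappa> - polytope_of \<eta> (\<kappa> - s *\<^sub>R axis p 1)) > 0"
  proof (rule corner_measure_pos[OF S(1) _ s])
    show "x \<in> polytope_of \<eta> \<kappa>" using x by (simp add: mem_facet)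
    show "polytope_of \<eta> \<kappa> - polytope_of \<eta> (\<kappa> - s *\<^sub>R axis p 1) \<in> lmeasurable"
      by (intro fmeasurable.Diff lmeasurable_polytope S)
    fix y assume y: "\<And>k. \<eta> k \<bullet> x - s < \<eta> k \<bullet> y \<and> \<eta> k \<bullet> y < \<kappa> $ k"
    have "\<eta> p \<bullet> x = \<kappa> $ p" using x by (simp add: mem_facet tight_def)
    then have "\<not> \<eta> p \<bullet> y \<le> \<kappa> $ p - s" using y[of p] by simp
    moreover have "y \<in> polytope_of \<eta> \<kappa>" using y by (auto simp: mem_polytope_of less_imp_le)
    ultimately show "y \<in> polytope_of \<eta> \<kappa> - polytope_of \<eta> (\<kappa> - s *\<^sub>R axis p 1)"
      using s by (simp add: polytope_dec_iff)
  qed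
  then show ?thesis using vol_diff[OF S] polytope_dec_subset s by (metis less_imp_le)
qed

text \<open>
  In particular, if one of two disjoint facets is asymmetric, so is the other.
\<close>

lemma disjoint_signs:
  assumes S: "simple_polytope \<eta> \<kappa>" and m: "mass_coeffs \<eta> \<kappa> H \<gamma> C"
    and pq: "p \<noteq> q" and d: "facet \<eta> \<kappa> p \<inter> facet \<eta> \<kappa> q = {}" and nz: "\<gamma> p \<noteq> 0"
  shows "\<gamma> p * \<gamma> q < 0"
proof -
  obtain \<epsilon>1 where e1: "\<epsilon>1 > 0" and ex: "\<And>s r. 0 \<le> s \<Longrightarrow> s \<le> \<epsilon>1 \<Longrightarrow> 0 \<le> r \<Longrightarrow> r \<le> \<epsilon>1 \<Longrightarrow>
     \<gamma> p * s * (vol \<eta> \<kappa> - vol \<eta> (\<kappa> - r *\<^sub>R axis q 1)) +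
     \<gamma> q * r * (vol \<eta> \<kappa> - vol \<eta> (\<kappa> - s *\<^sub>R axis p 1)) = 0"
    using slab_exchange[OF S m pq d] by auto
  obtain \<epsilon>2 where e2: "\<epsilon>2 > 0" and ch: "\<And>\<kappa>'. (\<And>k. \<bar>\<kappa>' $ k - \<kappa> $ k\<bar> \<le> \<epsilon>2) \<Longrightarrow> \<kappa>' \<in> chamber \<eta> \<kappa>"
    using nhds_box[OF chamber_near[OF S]] by blast
  define s where "s = min \<epsilon>1 \<epsilon>2"
  have s: "s > 0" "s \<le> \<epsilon>1" "s \<le> \<epsilon>2" using e1 e2 by (auto simp: s_def)
  have pol: "is_polytope \<eta> (\<kappa> - s *\<^sub>R axis k 1)" for k
    by (intro simple_is_polytope chamber_simple[of _ \<eta> \<kappa>] ch) (use s in \<open>simp add: axis_def\<close>)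
  let ?b = "vol \<eta> \<kappa> - vol \<eta> (\<kappa> - s *\<^sub>R axis q 1)" and ?a = "vol \<eta> \<kappa> - vol \<eta> (\<kappa> - s *\<^sub>R axis p 1)"
  have pos: "?a > 0" "?b > 0" using slab_pos[OF simple_is_polytope[OF S] pol s(1)] by auto
  have "s * (\<gamma> p * ?b + \<gamma> q * ?a) = 0" using ex[of s s] s by (simp add: algebra_simps)
  then have e: "\<gamma> q * ?a = - (\<gamma> p * ?b)" using s(1) by simp
  have "\<gamma> p * \<gamma> q * ?a = - (\<gamma> p * \<gamma> p * ?b)" using e by algebra
  moreover have "\<gamma> p * \<gamma> p * ?b > 0"
  proof (rule mult_pos_pos[OF _ pos(2)])
    show "0 < \<gamma> p * \<gamma> p" using nz by (metis not_real_square_gt_zero)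
  qed
  ultimately have "\<gamma> p * \<gamma> q * ?a < 0" by linarith
  then show ?thesis using pos(1) by (auto simp: mult_less_0_iff)
qed

text \<open>
  A facet \<open>F\<^sub>p\<close> with nonzero coefficient misses at most one other facet.  If it misses \<open>F\<^sub>q\<close> and \<open>F\<^sub>k\<close>,
  then cutting at \<open>F\<^sub>k\<close> leaves the slab at \<open>F\<^sub>p\<close> alone; by the exchange identity it leaves the volume of the
  slab at \<open>F\<^sub>q\<close> alone too, so \<open>F\<^sub>q\<close> and \<open>F\<^sub>k\<close> are disjoint.  Three pairwise disjoint facets cannot
  have coefficients of pairwise opposite sign.
\<close>

lemma meets_all_others:
  assumes S: "simple_polytope \<eta> \<kappa>" and m: "mass_coeffs \<eta> \<kappa> H \<gamma> C"
    and pq: "p \<noteq> q" and d: "facet \<eta> \<kappa> p \<inter> facet \<eta> \<kappa> q = {}" and nz: "\<gamma> p \<noteq> 0"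
    and k: "k \<noteq> p" "k \<noteq> q"
  shows "facet \<eta> \<kappa> p \<inter> facet \<eta> \<kappa> k \<noteq> {}"
proof
  assume dk: "facet \<eta> \<kappa> p \<inter> facet \<eta> \<kappa> k = {}"
  note P = simple_is_polytope[OF S]
  have "facet \<eta> \<kappa> q \<inter> facet \<eta> \<kappa> k = {}"
  proof (rule ccontr)
    assume "facet \<eta> \<kappa> q \<inter> facet \<eta> \<kappa> k \<noteq> {}"
    then obtain x where x: "x \<in> facet \<eta> \<kappa> q" "x \<in> facet \<eta> \<kappa> k" by blast
    obtain \<epsilon>1 where e1: "\<epsilon>1 > 0" and ex: "\<And>\<kappa>' s r. (\<And>k. \<bar>\<kappa>' $ k - \<kappa> $ k\<bar> \<le> \<epsilon>1) \<Longrightarrow> 0 \<le> s \<Longrightarrow> s \<le> \<epsilon>1 \<Longrightarrow> 0 \<le> r \<Longrightarrow> r \<le> \<epsilon>1 \<Longrightarrow>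
       \<gamma> p * s * (vol \<eta> \<kappa>' - vol \<eta> (\<kappa>' - r *\<^sub>R axis q 1)) +
       \<gamma> q * r * (vol \<eta> \<kappa>' - vol \<eta> (\<kappa>' - s *\<^sub>R axis p 1)) = 0"
      using slab_exchange[OF S m pq d] by auto
    obtain \<epsilon>3 where e3: "\<epsilon>3 > 0" and ex3: "\<And>s r. 0 \<le> s \<Longrightarrow> s \<le> \<epsilon>3 \<Longrightarrow> 0 \<le> r \<Longrightarrow> r \<le> \<epsilon>3 \<Longrightarrow>
       polytope_of \<eta> \<kappa> - polytope_of \<eta> (\<kappa> - s *\<^sub>R axis p 1) =
       polytope_of \<eta> (\<kappa> - r *\<^sub>R axis k 1) - polytope_of \<eta> (\<kappa> - r *\<^sub>R axis k 1 - s *\<^sub>R axis p 1)"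
      using slab_exchange[OF S m k(1)[symmetric] dk] by auto
    obtain \<epsilon>2 where e2: "\<epsilon>2 > 0" and ch: "\<And>\<kappa>'. (\<And>k. \<bar>\<kappa>' $ k - \<kappa> $ k\<bar> \<le> \<epsilon>2) \<Longrightarrow> \<kappa>' \<in> chamber \<eta> \<kappa>"
      using nhds_box[OF chamber_near[OF S]] by blast
    define s where "s = min \<epsilon>1 (min \<epsilon>2 \<epsilon>3)"
    have s: "s > 0" "s \<le> \<epsilon>1" "s \<le> \<epsilon>2" "s \<le> \<epsilon>3" using e1 e2 e3 by (auto simp: s_def)
    let ?k = "\<kappa> - s *\<^sub>R axis k 1"
    have pol: "is_polytope \<eta> (\<kappa> - s *\<^sub>R axis l 1)" for l
      by (intro simple_is_polytope chamber_simple[of _ \<eta> \<kappa>] ch) (use s in \<open>simp add: axis_def\<close>)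
    have pol2: "is_polytope \<eta> (\<kappa> - s *\<^sub>R axis k 1 - s *\<^sub>R axis l 1)" if "l \<noteq> k" for l
      by (intro simple_is_polytope chamber_simple[of _ \<eta> \<kappa>] ch) (use s that in \<open>simp add: axis_def\<close>)
    have sub: "polytope_of \<eta> (\<kappa>' - s *\<^sub>R axis l 1) \<subseteq> polytope_of \<eta> \<kappa>'" for \<kappa>' l
      using polytope_dec_subset s(1) by (metis less_imp_le)
    have a: "vol \<eta> \<kappa> - vol \<eta> (\<kappa> - s *\<^sub>R axis p 1) = vol \<eta> ?k - vol \<eta> (?k - s *\<^sub>R axis p 1)"
      using vol_diff[OF P pol sub, of p] vol_diff[OF pol pol2[OF k(1)[symmetric]] sub] ex3[of s s] s k by simp
    have eq1: "\<gamma> p * s * (vol \<eta> \<kappa> - vol \<eta> (\<kappa> - s *\<^sub>R axis q 1)) + 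
         \<gamma> q * s * (vol \<eta> \<kappa> - vol \<eta> (\<kappa> - s *\<^sub>R axis p 1)) = 0"
      by (rule ex) (use s in auto)
    have eq2: "\<gamma> p * s * (vol \<eta> ?k - vol \<eta> (?k - s *\<^sub>R axis q 1)) + 
         \<gamma> q * s * (vol \<eta> ?k - vol \<eta> (?k - s *\<^sub>R axis p 1)) = 0"
      by (rule ex) (use s in \<open>auto simp: axis_def\<close>)
    have "\<gamma> p * s * (vol \<eta> \<kappa> - vol \<eta> (\<kappa> - s *\<^sub>R axis q 1)) = \<gamma> p * s * (vol \<eta> ?k - vol \<eta> (?k - s *\<^sub>R axis q 1))"
      using eq1 eq2 unfolding a by linarith
    then have b: "vol \<eta> \<kappa> - vol \<eta> (\<kappa> - s *\<^sub>R axis q 1) = vol \<eta> ?k - vol \<eta> (?k - s *\<^sub>R axis q 1)"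
      using nz s(1) by simp
    let ?A = "polytope_of \<eta> \<kappa> - polytope_of \<eta> (\<kappa> - s *\<^sub>R axis q 1)" 
      and ?B = "polytope_of \<eta> ?k - polytope_of \<eta> (?k - s *\<^sub>R axis q 1)"
    have mem: "y \<in> ?B \<longleftrightarrow> y \<in> ?A \<and> \<eta> k \<bullet> y \<le> \<kappa> $ k - s" for y
      using s(1) k(2) by (simp add: polytope_dec_iff del: vector_minus_component) auto
    have mA: "?A \<in> lmeasurable" and mB: "?B \<in> lmeasurable"
      using k(2) by (intro fmeasurable.Diff lmeasurable_polytope P pol pol2; simp)+
    have "measure lebesgue (?A - ?B) = measure lebesgue ?A - measure lebesgue ?B"
      by (rule measurable_measure_Diff) (use mA mB mem fmeasurableD in auto)
    also have "\<dots> = 0"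
      using b vol_diff[OF P pol sub, of q] vol_diff[OF pol pol2[OF k(2)[symmetric]] sub] k by simp
    finally have "measure lebesgue (?A - ?B) = 0" .
    moreover have "measure lebesgue (?A - ?B) > 0"
    proof (rule corner_measure_pos[OF P _ s(1)])
      show "x \<in> polytope_of \<eta> \<kappa>" using x by (simp add: mem_facet)
      show "?A - ?B \<in> lmeasurable" by (intro fmeasurable.Diff mA mB)
      fix y assume y: "\<And>k. \<eta> k \<bullet> x - s < \<eta> k \<bullet> y \<and> \<eta> k \<bullet> y < \<kappa> $ k"
      have "\<eta> q \<bullet> x = \<kappa> $ q" "\<eta> k \<bullet> x = \<kappa> $ k" using x by (simp_all add: mem_facet tight_def)
      then have "\<not> \<eta> q \<bullet> y \<le> \<kappa> $ q - s" "\<not> \<eta> k \<bullet> y \<le> \<kappa> $ k - s" using y[of q] y[of k] by simp_all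
      moreover have "y \<in> polytope_of \<eta> \<kappa>" using y by (auto simp: mem_polytope_of less_imp_le)
      ultimately show "y \<in> ?A - ?B" using s(1) mem[of y] by (simp add: polytope_dec_iff)
    qed
    ultimately show False by simp
  qed
  then have dq: "facet \<eta> \<kappa> q \<inter> facet \<eta> \<kappa> k = {}" .
  have 1: "\<gamma> p * \<gamma> q < 0" by (rule disjoint_signs[OF S m pq d nz])
  have 2: "\<gamma> p * \<gamma> k < 0" by (rule disjoint_signs[OF S m k(1)[symmetric] dk nz])
  have "\<gamma> q \<noteq> 0" using 1 by auto
  then have 3: "\<gamma> q * \<gamma> k < 0" by (rule disjoint_signs[OF S m k(2)[symmetric] dq])
  show False using 1 2 3 by (auto simp: mult_less_0_iff)
qed

text \<open>
  In the exchange identity with \<open>r\<close> fixed, the slab volume at \<open>F\<^sub>p\<close> is proportional to its thickness \<open>s\<close>,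
  for all support numbers near \<open>\<kappa>\<close>.
\<close>

lemma slab_linear:
  assumes S: "simple_polytope \<eta> \<kappa>" and m: "mass_coeffs \<eta> \<kappa> H \<gamma> C"
    and pq: "p \<noteq> q" and d: "facet \<eta> \<kappa> p \<inter> facet \<eta> \<kappa> q = {}" and nz: "\<gamma> p \<noteq> 0"
  shows "\<exists>\<epsilon>>0. \<forall>\<kappa>' s. (\<forall>k. \<bar>\<kappa>' $ k - \<kappa> $ k\<bar> \<le> \<epsilon>) \<longrightarrow> 0 \<le> s \<longrightarrow> s \<le> \<epsilon> \<longrightarrow>
     vol \<eta> \<kappa>' - vol \<eta> (\<kappa>' - (2 * s) *\<^sub>R axis p 1) = 2 * (vol \<eta> \<kappa>' - vol \<eta> (\<kappa>' - s *\<^sub>R axis p 1))"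
proof -
  have nq: "\<gamma> q \<noteq> 0" using disjoint_signs[OF S m pq d nz] by auto
  obtain \<epsilon> where e: "\<epsilon> > 0" and ex: "\<And>\<kappa>' s r. (\<And>k. \<bar>\<kappa>' $ k - \<kappa> $ k\<bar> \<le> \<epsilon>) \<Longrightarrow> 0 \<le> s \<Longrightarrow> s \<le> \<epsilon> \<Longrightarrow> 0 \<le> r \<Longrightarrow> r \<le> \<epsilon> \<Longrightarrow>
       \<gamma> p * s * (vol \<eta> \<kappa>' - vol \<eta> (\<kappa>' - r *\<^sub>R axis q 1)) +
       \<gamma> q * r * (vol \<eta> \<kappa>' - vol \<eta> (\<kappa>' - s *\<^sub>R axis p 1)) = 0"
      using slab_exchange[OF S m pq d] by auto
  have "vol \<eta> \<kappa>' - vol \<eta> (\<kappa>' - (2 * s) *\<^sub>R axis p 1) = 2 * (vol \<eta> \<kappa>' - vol \<eta> (\<kappa>' - s *\<^sub>R axis p 1))"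
    if k: "\<And>k. \<bar>\<kappa>' $ k - \<kappa> $ k\<bar> \<le> \<epsilon>/2" and s: "0 \<le> s" "s \<le> \<epsilon>/2" for \<kappa>' s
  proof -
    have k': "\<bar>\<kappa>' $ k - \<kappa> $ k\<bar> \<le> \<epsilon>" for k using k[of k] e by simp
    let ?b = "vol \<eta> \<kappa>' - vol \<eta> (\<kappa>' - \<epsilon> *\<^sub>R axis q 1)"
    have "\<gamma> p * s * ?b + \<gamma> q * \<epsilon> * (vol \<eta> \<kappa>' - vol \<eta> (\<kappa>' - s *\<^sub>R axis p 1)) = 0"
      by (rule ex[OF k']) (use s e in auto)
    moreover have "\<gamma> p * (2 * s) * ?b + \<gamma> q * \<epsilon> * (vol \<eta> \<kappa>' - vol \<eta> (\<kappa>' - (2 * s) *\<^sub>R axis p 1)) = 0"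
      by (rule ex[OF k']) (use s e in auto)
    ultimately have "\<gamma> q * \<epsilon> * (vol \<eta> \<kappa>' - vol \<eta> (\<kappa>' - (2 * s) *\<^sub>R axis p 1) - 2 * (vol \<eta> \<kappa>' - vol \<eta> (\<kappa>' - s *\<^sub>R axis p 1))) = 0"
      by algebra
    then show ?thesis using nq e by simp
  qed
  then show ?thesis using e by (intro exI[of _ "\<epsilon>/2"]) auto
qed

section \<open>Flatness along an edge\<close>

text \<open>
  The part of the polytope within depth \<open>s\<close> of the facet \<open>i\<close> and within depth \<open>u\<close> of each
  facet in \<open>T\<close>.
\<close>

definition corner :: "('n::finite \<Rightarrow> 'a::euclidean_space) \<Rightarrow> real ^ 'n \<Rightarrow> 'n \<Rightarrow> 'n set \<Rightarrow> real \<Rightarrow> real \<Rightarrow> 'a set" where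
  "corner \<eta> \<kappa> i T s u = {x \<in> polytope_of \<eta> \<kappa>. \<eta> i \<bullet> x > \<kappa> $ i - s \<and> (\<forall>k\<in>T. \<eta> k \<bullet> x > \<kappa> $ k - u)}"

lemma lmeasurable_corner:
  assumes "is_polytope \<eta> \<kappa>" shows "corner \<eta> \<kappa> i T s u \<in> lmeasurable"
proof -
  let ?U = "{x. \<eta> i \<bullet> x > \<kappa> $ i - s} \<inter> (\<Inter>k\<in>T. {x. \<eta> k \<bullet> x > \<kappa> $ k - u})"
  have "open ?U" by (intro open_Int open_INT ballI open_halfspace_gt finite)
  then have "?U \<in> sets lebesgue" by (intro sets_completionI_sets) (simp add: borel_open)
  moreover have "corner \<eta> \<kappa> i T s u = polytope_of \<eta> \<kappa> \<inter> ?U" by (auto simp: corner_def)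
  ultimately show ?thesis by (simp add: fmeasurable_Int_fmeasurable lmeasurable_polytope[OF assms])
qed

lemma corner_insert:
  assumes "k \<notin> T" "k \<noteq> i" "0 \<le> u"
  shows "corner \<eta> \<kappa> i (insert k T) s u = corner \<eta> \<kappa> i T s u - corner \<eta> (\<kappa> - u *\<^sub>R axis k 1) i T s u"
    and "corner \<eta> (\<kappa> - u *\<^sub>R axis k 1) i T s u \<subseteq> corner \<eta> \<kappa> i T s u"
proof -
  have mem: "x \<in> corner \<eta> (\<kappa> - u *\<^sub>R axis k 1) i T s u \<longleftrightarrow> x \<in> corner \<eta> \<kappa> i T s u \<and> \<eta> k \<bullet> x \<le> \<kappa> $ k - u" for x
  proof -
    have "(\<forall>l\<in>T. \<eta> l \<bullet> x > (\<kappa> - u *\<^sub>R axis k 1) $ l - u) \<longleftrightarrow> (\<forall>l\<in>T. \<eta> l \<bullet> x > \<kappa> $ l - u)"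
      unfolding dec_nth using assms(1) by (intro ball_cong refl) auto
    then show ?thesis unfolding corner_def mem_Collect_eq polytope_dec_iff[OF assms(3)] dec_nth 
      using assms(2) by auto
  qed
  show "corner \<eta> \<kappa> i (insert k T) s u = corner \<eta> \<kappa> i T s u - corner \<eta> (\<kappa> - u *\<^sub>R axis k 1) i T s u"
    by (rule set_eqI) (auto simp: mem, auto simp: corner_def)
  show "corner \<eta> (\<kappa> - u *\<^sub>R axis k 1) i T s u \<subseteq> corner \<eta> \<kappa> i T s u"
    using mem by blast
qed

text \<open>
  For all support numbers near \<open>\<kappa>\<close>, doubling the thickness of a thin slab at the facet \<open>i\<close> doubles
  its volume.
\<close>

definition slab_doubling :: "('n::finite \<Rightarrow> 'a::euclidean_space) \<Rightarrow> real ^ 'n \<Rightarrow> 'n \<Rightarrow> bool" where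
  "slab_doubling \<eta> \<kappa> i \<longleftrightarrow> (\<exists>\<epsilon>>0. \<forall>\<kappa>' s. (\<forall>k. \<bar>\<kappa>' $ k - \<kappa> $ k\<bar> \<le> \<epsilon>) \<longrightarrow> 0 \<le> s \<longrightarrow> s \<le> \<epsilon> \<longrightarrow>
     vol \<eta> \<kappa>' - vol \<eta> (\<kappa>' - (2 * s) *\<^sub>R axis i 1) = 2 * (vol \<eta> \<kappa>' - vol \<eta> (\<kappa>' - s *\<^sub>R axis i 1)))"

text \<open>
  Differencing the slab volume in the support numbers of the facets in \<open>T\<close> transfers the doubling
  property from the slab to the corner pieces.  This localises it near the face of \<open>F\<^sub>i\<close> cut out by \<open>T\<close>.
\<close>

lemma corner_doubling:
  assumes S: "simple_polytope \<eta> \<kappa>" and D: "slab_doubling \<eta> \<kappa> i"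
  shows "\<exists>\<epsilon>>0. \<forall>T s. i \<notin> T \<longrightarrow> 0 < s \<longrightarrow> s \<le> \<epsilon> \<longrightarrow>
    measure lebesgue (corner \<eta> \<kappa> i T (2 * s) s) = 2 * measure lebesgue (corner \<eta> \<kappa> i T s s)"
proof -
  obtain \<epsilon>1 where e1: "\<epsilon>1 > 0" and lin: "\<And>\<kappa>' s. (\<And>k. \<bar>\<kappa>' $ k - \<kappa> $ k\<bar> \<le> \<epsilon>1) \<Longrightarrow> 0 \<le> s \<Longrightarrow> s \<le> \<epsilon>1 \<Longrightarrow>
     vol \<eta> \<kappa>' - vol \<eta> (\<kappa>' - (2 * s) *\<^sub>R axis i 1) = 2 * (vol \<eta> \<kappa>' - vol \<eta> (\<kappa>' - s *\<^sub>R axis i 1))"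
    using D unfolding slab_doubling_def by blast
  obtain \<epsilon>2 where e2: "\<epsilon>2 > 0" and pol: "\<And>\<kappa>'. (\<And>k. \<bar>\<kappa>' $ k - \<kappa> $ k\<bar> \<le> \<epsilon>2) \<Longrightarrow> simple_polytope \<eta> \<kappa>'"
    using nhds_box[OF open_simple[OF S]] by blast
  define \<epsilon> where "\<epsilon> = min \<epsilon>1 (\<epsilon>2 / 3)"
  have e: "\<epsilon> > 0" "\<epsilon> \<le> \<epsilon>1" "3 * \<epsilon> \<le> \<epsilon>2" using e1 e2 by (auto simp: \<epsilon>_def)
  have "measure lebesgue (corner \<eta> \<kappa>' i T (2 * s) s) = 2 * measure lebesgue (corner \<eta> \<kappa>' i T s s)"
    if "i \<notin> T" "0 < s" "s \<le> \<epsilon>" "\<And>k. \<bar>\<kappa>' $ k - \<kappa> $ k\<bar> \<le> \<epsilon>" "\<And>k. k \<in> T \<Longrightarrow> \<kappa>' $ k = \<kappa> $ k" for T s \<kappa>'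
  proof -
    have "finite T" by simp
    then show ?thesis using that
    proof (induction T arbitrary: \<kappa>' rule: finite_induct)
      case empty
      have pd: "is_polytope \<eta> (\<kappa>' - r *\<^sub>R axis i 1)" if "0 \<le> r" "r \<le> 2 * \<epsilon>" for r
      proof (rule simple_is_polytope[OF pol])
        fix k show "\<bar>(\<kappa>' - r *\<^sub>R axis i 1) $ k - \<kappa> $ k\<bar> \<le> \<epsilon>2"
          unfolding dec_nth using empty.prems(4)[of k] that e by (cases "k = i") auto
      qed
      have p0: "is_polytope \<eta> \<kappa>'" using pd[of 0] e by simp
      have "measure lebesgue (corner \<eta> \<kappa>' i {} r s) = vol \<eta> \<kappa>' - vol \<eta> (\<kappa>' - r *\<^sub>R axis i 1)" 
        if "0 \<le> r" "r \<le> 2 * \<epsilon>" for r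
      proof -
        have "corner \<eta> \<kappa>' i {} r s = polytope_of \<eta> \<kappa>' - polytope_of \<eta> (\<kappa>' - r *\<^sub>R axis i 1)"
          using that by (auto simp: corner_def polytope_dec_iff)
        then show ?thesis using vol_diff[OF p0 pd[OF that] polytope_dec_subset[OF that(1)]] by simp
      qed
      moreover have "vol \<eta> \<kappa>' - vol \<eta> (\<kappa>' - (2 * s) *\<^sub>R axis i 1) = 2 * (vol \<eta> \<kappa>' - vol \<eta> (\<kappa>' - s *\<^sub>R axis i 1))"
      proof (rule lin)
        fix k show "\<bar>\<kappa>' $ k - \<kappa> $ k\<bar> \<le> \<epsilon>1" using empty.prems(4)[of k] e by linarith
      qed (use empty.prems(2,3) e in linarith)+
      ultimately show ?case using empty.prems by simp
    next
      case (insert k T)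
      have ki: "k \<noteq> i" "i \<notin> T" using insert.prems(1) by auto
      let ?k = "\<kappa>' - s *\<^sub>R axis k 1"
      have dev: "\<bar>?k $ l - \<kappa> $ l\<bar> \<le> \<epsilon>" for l
        unfolding dec_nth using insert.prems(2,3,5) insert.prems(4)[of l] by (cases "l = k") auto
      have p: "is_polytope \<eta> \<kappa>'" "is_polytope \<eta> ?k"
      proof -
        show "is_polytope \<eta> \<kappa>'"
        proof (rule simple_is_polytope[OF pol])
          fix l show "\<bar>\<kappa>' $ l - \<kappa> $ l\<bar> \<le> \<epsilon>2" using insert.prems(4)[of l] e by linarith
        qed
        show "is_polytope \<eta> ?k"
        proof (rule simple_is_polytope[OF pol])
          fix l show "\<bar>?k $ l - \<kappa> $ l\<bar> \<le> \<epsilon>2" using dev[of l] e by linarith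
        qed
      qed
      have eq: "measure lebesgue (corner \<eta> \<kappa>' i (insert k T) r s) =
        measure lebesgue (corner \<eta> \<kappa>' i T r s) - measure lebesgue (corner \<eta> ?k i T r s)" for r
      proof -
        have s0: "0 \<le> s" using insert.prems(2) by simp
        show ?thesis unfolding corner_insert(1)[OF insert.hyps(2) ki(1) s0]
          by (rule measurable_measure_Diff[OF lmeasurable_corner[OF p(1)]
              fmeasurableD[OF lmeasurable_corner[OF p(2)]] corner_insert(2)[OF insert.hyps(2) ki(1) s0]])
      qed
      have "measure lebesgue (corner \<eta> \<kappa>' i T (2 * s) s) = 2 * measure lebesgue (corner \<eta> \<kappa>' i T s s)"
        by (rule insert.IH) (use insert.prems ki in auto)
      moreover have "measure lebesgue (corner \<eta> ?k i T (2 * s) s) = 2 * measure lebesgue (corner \<eta> ?k i T s s)"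
      proof (rule insert.IH[OF ki(2) insert.prems(2,3) dev])
        fix l assume "l \<in> T"
        then show "?k $ l = \<kappa> $ l" unfolding dec_nth using insert by auto
      qed
      ultimately show ?case unfolding eq by simp
    qed
  qed
  then show ?thesis using e(1) by (intro exI[of _ \<epsilon>]) simp
qed

text \<open>
  Suppose that the conormal of a constraint inactive at the vertex \<open>v\<close> has a nonnegative coefficient on
  \<open>\<eta> m\<close> in the basis of conormals tight at \<open>v\<close>.  Then the constraints in \<open>A\<close>, nearly tight, together
  with the constraint \<open>m\<close> imply it.
\<close>

lemma vertex_bound:
  fixes \<eta> :: "'n::finite \<Rightarrow> 'a::euclidean_space"
  assumes v: "v \<in> polytope_of \<eta> \<kappa>" "tight \<eta> \<kappa> v = insert m A" "m \<notin> A"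
    and q: "q \<notin> tight \<eta> \<kappa> v" and c: "\<eta> q = (\<Sum>k\<in>insert m A. c k *\<^sub>R \<eta> k)" "0 \<le> c m"
  shows "\<forall>\<^sub>F e in at_right 0. \<forall>x. (\<forall>k\<in>A. \<kappa> $ k - e < \<eta> k \<bullet> x \<and> \<eta> k \<bullet> x \<le> \<kappa> $ k) \<longrightarrow> \<eta> m \<bullet> x \<le> \<kappa> $ m \<longrightarrow> \<eta> q \<bullet> x \<le> \<kappa> $ q"
proof -
  have gap: "\<eta> q \<bullet> v < \<kappa> $ q" using v(1) q by (auto simp: tight_def mem_polytope_of order_less_le)
  have fA: "finite A" by simp
  have tv: "\<eta> k \<bullet> v = \<kappa> $ k" if "k \<in> insert m A" for k using v(2) that by (auto simp: tight_def)
  have ex: "\<eta> q \<bullet> y = c m * (\<eta> m \<bullet> y) + (\<Sum>k\<in>A. c k * (\<eta> k \<bullet> y))" for y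
    unfolding c(1) sum.insert[OF fA v(3)] by (simp add: inner_add_left inner_sum_left)
  define B where "B = (\<Sum>k\<in>A. \<bar>c k\<bar>)"
  have B: "B \<ge> 0" unfolding B_def by (intro sum_nonneg) auto
  have lim: "((\<lambda>e. e * B) \<longlongrightarrow> 0 * B) (at_right (0::real))" by (intro tendsto_intros)
  have "\<forall>\<^sub>F e in at_right 0. e * B < \<kappa> $ q - \<eta> q \<bullet> v"
    by (rule order_tendstoD(2)[OF lim]) (use gap in simp)
  then show ?thesis
  proof (rule eventually_mono, intro allI impI)
    fix e x assume e: "e * B < \<kappa> $ q - \<eta> q \<bullet> v"
      and x: "\<forall>k\<in>A. \<kappa> $ k - e < \<eta> k \<bullet> x \<and> \<eta> k \<bullet> x \<le> \<kappa> $ k" "\<eta> m \<bullet> x \<le> \<kappa> $ m"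
    have "\<eta> q \<bullet> x - \<eta> q \<bullet> v = c m * (\<eta> m \<bullet> x - \<kappa> $ m) + (\<Sum>k\<in>A. c k * (\<eta> k \<bullet> x - \<kappa> $ k))"
      unfolding ex using tv by (simp add: algebra_simps sum_subtractf)
    also have "\<dots> \<le> 0 + (\<Sum>k\<in>A. \<bar>c k\<bar> * e)"
    proof (rule add_mono)
      show "c m * (\<eta> m \<bullet> x - \<kappa> $ m) \<le> 0" using c(2) x(2) by (simp add: mult_nonneg_nonpos)
      show "(\<Sum>k\<in>A. c k * (\<eta> k \<bullet> x - \<kappa> $ k)) \<le> (\<Sum>k\<in>A. \<bar>c k\<bar> * e)"
      proof (rule sum_mono)
        fix k assume "k \<in> A"
        then have "\<bar>\<eta> k \<bullet> x - \<kappa> $ k\<bar> \<le> e" using x(1) by force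
        then have "\<bar>c k * (\<eta> k \<bullet> x - \<kappa> $ k)\<bar> \<le> \<bar>c k\<bar> * e" unfolding abs_mult by (rule mult_left_mono) simp
        then show "c k * (\<eta> k \<bullet> x - \<kappa> $ k) \<le> \<bar>c k\<bar> * e" by linarith
      qed
    qed
    also have "\<dots> = e * B" by (simp add: B_def sum_distrib_left mult.commute)
    finally show "\<eta> q \<bullet> x \<le> \<kappa> $ q" using e by linarith
  qed
qed

text \<open>
  A neighbourhood of the edge on which the constraints in \<open>A\<close> are tight and whose ends are cut
  off by the constraints \<open>m\<close> and \<open>l\<close>.  The bound \<open>b\<close> for the constraint \<open>l\<close> is variable.
\<close>

definition edge_strip :: "('n::finite \<Rightarrow> 'a::euclidean_space) \<Rightarrow> real ^ 'n \<Rightarrow> 'n set \<Rightarrow> 'n \<Rightarrow> 'n \<Rightarrow> real \<Rightarrow> real \<Rightarrow> 'a set" where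
  "edge_strip \<eta> \<kappa> A m l e b =
     {x. (\<forall>k\<in>A. \<kappa> $ k - e < \<eta> k \<bullet> x \<and> \<eta> k \<bullet> x \<le> \<kappa> $ k) \<and> \<eta> m \<bullet> x \<le> \<kappa> $ m \<and> \<eta> l \<bullet> x \<le> b}"

text \<open>
  Near an edge from \<open>v\<close> to \<open>w\<close>, the constraints tight at \<open>v\<close> or \<open>w\<close> imply all others.  Along the edge
  \<open>\<eta> m\<close> decreases and \<open>\<eta> l\<close> increases, so every other conormal has a nonnegative coefficient on \<open>\<eta> m\<close> in
  the basis at \<open>v\<close> or on \<open>\<eta> l\<close> in the basis at \<open>w\<close>.
\<close>

lemma edge_neighbourhood:
  fixes \<eta> :: "'n::finite \<Rightarrow> 'a::euclidean_space"
  assumes S: "simple_polytope \<eta> \<kappa>"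
    and v: "v \<in> polytope_of \<eta> \<kappa>" "rigid \<eta> (tight \<eta> \<kappa> v)" "tight \<eta> \<kappa> v = insert m A" "m \<notin> A"
    and w: "w \<in> polytope_of \<eta> \<kappa>" "rigid \<eta> (tight \<eta> \<kappa> w)" "tight \<eta> \<kappa> w = insert l A" "l \<notin> A"
    and lm: "l \<noteq> m"
  shows "\<exists>e>0. edge_strip \<eta> \<kappa> A m l e (\<kappa> $ l) \<subseteq> polytope_of \<eta> \<kappa>"
proof -
  have one: "\<forall>\<^sub>F e in at_right 0. edge_strip \<eta> \<kappa> A m l e (\<kappa> $ l) \<subseteq> {x. \<eta> q \<bullet> x \<le> \<kappa> $ q}" for q
  proof (cases "q \<in> insert m (insert l A)")
    case True
    then show ?thesis by (intro always_eventually) (auto simp: edge_strip_def)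
  next
    case False
    then have q: "q \<notin> tight \<eta> \<kappa> v" "q \<notin> tight \<eta> \<kappa> w" using v(3) w(3) by auto
    obtain c where c: "\<eta> q = (\<Sum>k\<in>insert m A. c k *\<^sub>R \<eta> k)"
      unfolding v(3)[symmetric] using rigid_expand[OF v(2) simpleD[OF S v(1,2)], of "\<eta> q"] by blast
    obtain c' where c': "\<eta> q = (\<Sum>k\<in>insert l A. c' k *\<^sub>R \<eta> k)"
      unfolding w(3)[symmetric] using rigid_expand[OF w(2) simpleD[OF S w(1,2)], of "\<eta> q"] by blast
    have Az: "\<eta> k \<bullet> (w - v) = 0" if "k \<in> A" for k
    proof -
      have "k \<in> tight \<eta> \<kappa> v" "k \<in> tight \<eta> \<kappa> w" using that v(3) w(3) by auto
      then show ?thesis by (simp add: tight_def inner_diff_right)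
    qed
    have fA: "finite A" by simp
    have "\<eta> q \<bullet> (w - v) = c m * (\<eta> m \<bullet> (w - v)) + (\<Sum>k\<in>A. c k * (\<eta> k \<bullet> (w - v)))"
      unfolding c sum.insert[OF fA v(4)] by (simp only: inner_add_left inner_sum_left inner_scaleR_left)
    then have E1: "\<eta> q \<bullet> (w - v) = c m * (\<eta> m \<bullet> (w - v))" using Az by simp
    have "\<eta> q \<bullet> (w - v) = c' l * (\<eta> l \<bullet> (w - v)) + (\<Sum>k\<in>A. c' k * (\<eta> k \<bullet> (w - v)))"
      unfolding c' sum.insert[OF fA w(4)] by (simp only: inner_add_left inner_sum_left inner_scaleR_left)
    then have E2: "\<eta> q \<bullet> (w - v) = c' l * (\<eta> l \<bullet> (w - v))" using Az by simp
    have "m \<notin> tight \<eta> \<kappa> w" "l \<notin> tight \<eta> \<kappa> v" using v w lm by auto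
    then have "\<eta> m \<bullet> w < \<kappa> $ m" "\<eta> l \<bullet> v < \<kappa> $ l" 
      using v(1) w(1) by (auto simp: tight_def mem_polytope_of order_less_le)
    moreover have "m \<in> tight \<eta> \<kappa> v" "l \<in> tight \<eta> \<kappa> w" using v(3) w(3) by auto
    then have "\<eta> m \<bullet> v = \<kappa> $ m" "\<eta> l \<bullet> w = \<kappa> $ l" by (simp_all add: tight_def)
    ultimately have sg: "\<eta> m \<bullet> (w - v) < 0" "\<eta> l \<bullet> (w - v) > 0" by (simp_all add: inner_diff_right)
    show ?thesis
    proof (cases "0 \<le> c m")
      case True
      from vertex_bound[OF v(1,3,4) q(1) c True] show ?thesis by (rule eventually_mono) (auto simp: edge_strip_def)
    next
      case False
      then have "c' l * (\<eta> l \<bullet> (w - v)) > 0" using E1 E2 sg(1) by (simp add: mult_neg_neg)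
      then have "0 \<le> c' l" using sg(2) by (simp add: zero_less_mult_iff)
      from vertex_bound[OF w(1,3,4) q(2) c' this] show ?thesis by (rule eventually_mono) (auto simp: edge_strip_def)
    qed
  qed
  have "\<forall>\<^sub>F e in at_right 0. \<forall>q. edge_strip \<eta> \<kappa> A m l e (\<kappa> $ l) \<subseteq> {x. \<eta> q \<bullet> x \<le> \<kappa> $ q}"
    by (rule eventually_all_finite) (rule one)
  from eventually_at_right_ex[OF this] show ?thesis
    unfolding polytope_of_def le_INF_iff by simp
qed

text \<open>
  The edges of \<open>\<Delta>\<close> that leave \<open>F\<^sub>i\<close> at the two ends of an edge of \<open>F\<^sub>i\<close> are parallel.  Let \<open>\<zeta>\<close> be the
  inward edge direction at \<open>v\<close>.  By the doubling property the part of the corner at depth between \<open>s\<close>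
  and \<open>2 * s\<close> has the same volume as the part at depth less than \<open>s\<close>.  Translation by \<open>s *\<^sub>R \<zeta>\<close> takes the
  latter part to the former, except that the bound for the constraint \<open>l\<close> is off by \<open>s * (\<eta> l \<bullet> \<zeta>)\<close>.  As
  the volume is strictly monotone in that bound, \<open>\<eta> l \<bullet> \<zeta> = 0\<close>.
\<close>

lemma edge_transport:
  fixes \<eta> :: "'n::finite \<Rightarrow> 'a::euclidean_space"
  assumes S: "simple_polytope \<eta> \<kappa>" and D: "slab_doubling \<eta> \<kappa> i"
    and v: "v \<in> polytope_of \<eta> \<kappa>" "rigid \<eta> (tight \<eta> \<kappa> v)" "tight \<eta> \<kappa> v = insert m A" "m \<notin> A"
    and w: "w \<in> polytope_of \<eta> \<kappa>" "rigid \<eta> (tight \<eta> \<kappa> w)" "tight \<eta> \<kappa> w = insert l A" "l \<notin> A"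
    and lm: "l \<noteq> m" and i: "i \<in> A"
    and \<zeta>: "\<eta> i \<bullet> \<zeta> = -1" "\<And>k. k \<in> A \<Longrightarrow> k \<noteq> i \<Longrightarrow> \<eta> k \<bullet> \<zeta> = 0" "\<eta> m \<bullet> \<zeta> = 0"
  shows "\<eta> l \<bullet> \<zeta> = 0"
proof -
  note P = simple_is_polytope[OF S]
  obtain e1 where e1: "e1 > 0" and strip: "edge_strip \<eta> \<kappa> A m l e1 (\<kappa> $ l) \<subseteq> polytope_of \<eta> \<kappa>"
    using edge_neighbourhood[OF S v w lm] by blast
  have nb: "x \<in> polytope_of \<eta> \<kappa>" if "\<And>k. k \<in> A \<Longrightarrow> \<kappa> $ k - e1 < \<eta> k \<bullet> x \<and> \<eta> k \<bullet> x \<le> \<kappa> $ k"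
     "\<eta> m \<bullet> x \<le> \<kappa> $ m" "\<eta> l \<bullet> x \<le> \<kappa> $ l" for x
    using that strip unfolding edge_strip_def by blast
  obtain e2 where e2: "e2 > 0" and dbl: "\<And>T s. i \<notin> T \<Longrightarrow> 0 < s \<Longrightarrow> s \<le> e2 \<Longrightarrow>
    measure lebesgue (corner \<eta> \<kappa> i T (2 * s) s) = 2 * measure lebesgue (corner \<eta> \<kappa> i T s s)"
    using corner_doubling[OF S D] by blast
  define s where "s = min (e1 / 2) e2"
  have s: "s > 0" "2 * s \<le> e1" "s \<le> e2" using e1 e2 by (auto simp: s_def)
  define p where "p = \<eta> l \<bullet> \<zeta>"
  define Q where "Q = edge_strip \<eta> \<kappa> A m l s"
  note Q_def = Q_def edge_strip_def
  let ?R1 = "corner \<eta> \<kappa> i (A - {i}) s s" and ?R2 = "corner \<eta> \<kappa> i (A - {i}) (2 * s) s"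
  have R1: "?R1 = Q (\<kappa> $ l)"
  proof (rule set_eqI)
    fix x
    have "x \<in> polytope_of \<eta> \<kappa>" if "x \<in> Q (\<kappa> $ l)"
    proof (rule nb)
      fix k assume "k \<in> A"
      then have "\<kappa> $ k - s < \<eta> k \<bullet> x \<and> \<eta> k \<bullet> x \<le> \<kappa> $ k" using that by (auto simp: Q_def)
      then show "\<kappa> $ k - e1 < \<eta> k \<bullet> x \<and> \<eta> k \<bullet> x \<le> \<kappa> $ k" using s by linarith
    qed (use that in \<open>auto simp: Q_def\<close>)
    moreover have "x \<in> Q (\<kappa> $ l)" if R: "x \<in> ?R1"
    proof -
      have le: "\<eta> k \<bullet> x \<le> \<kappa> $ k" for k using R by (simp add: corner_def mem_polytope_of)
      have "\<kappa> $ k - s < \<eta> k \<bullet> x" if "k \<in> A" for k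
        using R that by (cases "k = i") (simp_all add: corner_def)
      then show ?thesis unfolding Q_def using le by simp
    qed
    moreover have "x \<in> ?R1" if "x \<in> polytope_of \<eta> \<kappa>" "x \<in> Q (\<kappa> $ l)"
      using that i unfolding corner_def Q_def by simp
    ultimately show "x \<in> ?R1 \<longleftrightarrow> x \<in> Q (\<kappa> $ l)" by blast
  qed
  \<comment> \<open>The only mismatch under translation is in the bound of the constraint \<open>l\<close>.\<close>
  have R2: "?R2 - ?R1 = (+) (s *\<^sub>R \<zeta>) ` Q (\<kappa> $ l - s * p)"
  proof (rule set_eqI)
    fix x
    let ?y = "x - s *\<^sub>R \<zeta>"
    have yi: "\<eta> i \<bullet> ?y = \<eta> i \<bullet> x + s" and ym: "\<eta> m \<bullet> ?y = \<eta> m \<bullet> x" and yl: "\<eta> l \<bullet> ?y = \<eta> l \<bullet> x - s * p"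
      using \<zeta> by (simp_all add: inner_diff_right p_def)
    have yk: "\<eta> k \<bullet> ?y = \<eta> k \<bullet> x" if "k \<in> A" "k \<noteq> i" for k
      using \<zeta>(2)[OF that] by (simp add: inner_diff_right)
    have im: "x \<in> (+) (s *\<^sub>R \<zeta>) ` Q (\<kappa> $ l - s * p) \<longleftrightarrow> ?y \<in> Q (\<kappa> $ l - s * p)"
      unfolding image_iff by (metis add_diff_cancel_left' diff_add_cancel add.commute)
    have Ai: "(\<forall>k\<in>A. R k) \<longleftrightarrow> R i \<and> (\<forall>k\<in>A - {i}. R k)" for R using i by auto
    have yQ: "?y \<in> Q (\<kappa> $ l - s * p) \<longleftrightarrow> (\<kappa> $ i - 2 * s < \<eta> i \<bullet> x \<and> \<eta> i \<bullet> x \<le> \<kappa> $ i - s) \<and>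
       (\<forall>k\<in>A - {i}. \<kappa> $ k - s < \<eta> k \<bullet> x \<and> \<eta> k \<bullet> x \<le> \<kappa> $ k) \<and> \<eta> m \<bullet> x \<le> \<kappa> $ m \<and> \<eta> l \<bullet> x \<le> \<kappa> $ l"
      unfolding Q_def mem_Collect_eq Ai yi ym yl using yk by auto
    have "x \<in> polytope_of \<eta> \<kappa>" if "?y \<in> Q (\<kappa> $ l - s * p)"
    proof (rule nb)
      fix k assume "k \<in> A"
      then show "\<kappa> $ k - e1 < \<eta> k \<bullet> x \<and> \<eta> k \<bullet> x \<le> \<kappa> $ k" 
      proof (cases "k = i")
        case True
        then show ?thesis using that s unfolding yQ by auto
      next
        case False
        then have "\<kappa> $ k - s < \<eta> k \<bullet> x \<and> \<eta> k \<bullet> x \<le> \<kappa> $ k" using that \<open>k \<in> A\<close> unfolding yQ by blast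
        then show ?thesis using s by linarith
      qed
    qed (use that yQ in auto)
    moreover have "x \<in> ?R2 - ?R1 \<longleftrightarrow> x \<in> polytope_of \<eta> \<kappa> \<and> (\<kappa> $ i - 2 * s < \<eta> i \<bullet> x \<and> \<eta> i \<bullet> x \<le> \<kappa> $ i - s) \<and>
        (\<forall>k\<in>A - {i}. \<kappa> $ k - s < \<eta> k \<bullet> x)"
      using s(1) unfolding corner_def Diff_iff mem_Collect_eq by argo
    moreover have "x \<in> polytope_of \<eta> \<kappa> \<Longrightarrow> \<eta> k \<bullet> x \<le> \<kappa> $ k" for k by (simp add: mem_polytope_of)
    ultimately show "x \<in> ?R2 - ?R1 \<longleftrightarrow> x \<in> (+) (s *\<^sub>R \<zeta>) ` Q (\<kappa> $ l - s * p)"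
      unfolding im yQ by blast
  qed
  have mR: "?R1 \<in> lmeasurable" "?R2 \<in> lmeasurable" by (rule lmeasurable_corner[OF P])+
  have sub: "?R1 \<subseteq> ?R2" using s(1) by (auto simp: corner_def)
  have "measure lebesgue (?R2 - ?R1) = measure lebesgue ?R2 - measure lebesgue ?R1"
    by (rule measurable_measure_Diff[OF mR(2) fmeasurableD[OF mR(1)] sub])
  also have "\<dots> = measure lebesgue ?R1" using dbl[of "A - {i}" s] s by simp
  finally have eqQ: "measure lebesgue (Q (\<kappa> $ l - s * p)) = measure lebesgue (Q (\<kappa> $ l))"
    unfolding R2 measure_translation unfolding R1 .
  have mQ: "Q (\<kappa> $ l) \<in> lmeasurable" using mR R1 by simp
  have "(+) (s *\<^sub>R \<zeta>) ` Q (\<kappa> $ l - s * p) \<in> lmeasurable"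
    unfolding R2[symmetric] by (intro fmeasurable.Diff mR)
  from measurable_translation[OF this, of "- s *\<^sub>R \<zeta>"]
  have mQ': "Q (\<kappa> $ l - s * p) \<in> lmeasurable" by (simp add: image_image)
  have strict: "measure lebesgue (Q a) < measure lebesgue (Q b)"
    if ab: "a < b" "a = \<kappa> $ l \<or> b = \<kappa> $ l" "Q a \<in> lmeasurable" "Q b \<in> lmeasurable" for a b
  proof -
    \<comment> \<open>The region between the bounds \<open>a\<close> and \<open>b\<close> has interior points \<open>w + t *\<^sub>R d\<close>, just below or just above \<open>\<kappa> $ l\<close>.\<close>
    define \<sigma> :: real where "\<sigma> = (if b = \<kappa> $ l then -1 else 1)"
    obtain d where d: "\<And>k. k \<in> tight \<eta> \<kappa> w \<Longrightarrow> \<eta> k \<bullet> d = (if k = l then \<sigma> else -1)"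
      using rigid_dual[OF w(2) simpleD[OF S w(1,2)], of "\<lambda>k. if k = l then \<sigma> else -1"] by blast
    have tw: "\<eta> k \<bullet> w = \<kappa> $ k" if "k \<in> insert l A" for k
      using that unfolding w(3)[symmetric] by (simp add: tight_def)
    have dA: "\<eta> k \<bullet> d = -1" if "k \<in> A" for k using d[of k] that w(3,4) by auto
    have dl: "\<eta> l \<bullet> d = \<sigma>" using d[of l] w(3) by auto
    have pos: "\<forall>\<^sub>F t in at_right (0::real). 0 < t" by (rule eventually_at_right_less)
    have EA: "\<forall>\<^sub>F t in at_right (0::real). \<forall>k\<in>A. \<eta> k \<bullet> (w + t *\<^sub>R d) > \<kappa> $ k - s"
      by (rule eventually_ball_finite[OF _ ballI], simp, rule eventually_add_small(2)) (use tw s(1) in auto)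
    have Em: "\<forall>\<^sub>F t in at_right (0::real). \<eta> m \<bullet> (w + t *\<^sub>R d) < \<kappa> $ m"
    proof (rule eventually_add_small(1))
      have "m \<notin> tight \<eta> \<kappa> w" using v w lm by auto
      then show "\<eta> m \<bullet> w < \<kappa> $ m" using w(1) by (auto simp: tight_def mem_polytope_of order_less_le)
    qed
    have lim: "((\<lambda>t. \<kappa> $ l + t * \<sigma>) \<longlongrightarrow> \<kappa> $ l + 0 * \<sigma>) (at_right (0::real))" by (intro tendsto_intros)
    have El: "\<forall>\<^sub>F t in at_right (0::real). a < \<kappa> $ l + t * \<sigma> \<and> \<kappa> $ l + t * \<sigma> < b"
    proof (cases "b = \<kappa> $ l")
      case True
      have "\<forall>\<^sub>F t in at_right (0::real). a < \<kappa> $ l + t * \<sigma>"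
        by (rule order_tendstoD(1)[OF lim]) (use True ab in simp)
      with pos show ?thesis by eventually_elim (use True in \<open>simp add: \<sigma>_def\<close>)
    next
      case False
      then have a: "a = \<kappa> $ l" using ab by simp
      have "\<forall>\<^sub>F t in at_right (0::real). \<kappa> $ l + t * \<sigma> < b"
        by (rule order_tendstoD(2)[OF lim]) (use a ab in simp)
      with pos show ?thesis by eventually_elim (use False a in \<open>simp add: \<sigma>_def\<close>)
    qed
    obtain t where t: "t > 0" "\<And>k. k \<in> A \<Longrightarrow> \<eta> k \<bullet> (w + t *\<^sub>R d) > \<kappa> $ k - s" "\<eta> m \<bullet> (w + t *\<^sub>R d) < \<kappa> $ m"
      "a < \<kappa> $ l + t * \<sigma>" "\<kappa> $ l + t * \<sigma> < b"
      using eventually_at_right_ex[OF eventually_conj[OF EA eventually_conj[OF Em El]]] by blast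
    let ?U = "(\<Inter>k\<in>A. {x. \<eta> k \<bullet> x > \<kappa> $ k - s} \<inter> {x. \<eta> k \<bullet> x < \<kappa> $ k}) \<inter> {x. \<eta> m \<bullet> x < \<kappa> $ m} \<inter>
       ({x. \<eta> l \<bullet> x > a} \<inter> {x. \<eta> l \<bullet> x < b})"
    have "measure lebesgue (Q b - Q a) > 0"
    proof (rule open_subset_measure_pos)
      show "open ?U" by (intro open_Int open_INT ballI open_halfspace_gt open_halfspace_lt finite)
      show "w + t *\<^sub>R d \<in> ?U" using t tw dA dl by (auto simp: inner_add_right)
      show "?U \<subseteq> Q b - Q a" by (auto simp: Q_def less_imp_le)
      show "Q b - Q a \<in> lmeasurable" by (intro fmeasurable.Diff ab)
    qed
    also have "measure lebesgue (Q b - Q a) = measure lebesgue (Q b) - measure lebesgue (Q a)"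
      by (rule measurable_measure_Diff[OF ab(4) fmeasurableD[OF ab(3)]]) (use ab(1) in \<open>auto simp: Q_def\<close>)
    finally show ?thesis by simp
  qed
  show ?thesis
  proof (rule ccontr)
    assume "\<eta> l \<bullet> \<zeta> \<noteq> 0"
    then have "p < 0 \<or> p > 0" by (auto simp: p_def)
    then show False
    proof
      assume "p < 0"
      then have "s * p < 0" using s(1) by (simp add: mult_pos_neg)
      then show False using strict[OF _ _ mQ mQ'] eqQ by simp
    next
      assume "p > 0"
      then have "s * p > 0" using s(1) by simp
      then show False using strict[OF _ _ mQ' mQ] eqQ by simp
    qed
  qed
qed

section \<open>Flat facets\<close>

text \<open>
  A pivot of the simplex algorithm: the edge leaving a vertex along \<open>d\<close> ends in another vertex, at which
  the constraint \<open>l\<close> replaces the constraint \<open>m\<close>.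
\<close>

lemma pivot:
  fixes \<eta> :: "'n::finite \<Rightarrow> 'a::euclidean_space"
  assumes S: "simple_polytope \<eta> \<kappa>"
    and v: "v \<in> polytope_of \<eta> \<kappa>" "rigid \<eta> (tight \<eta> \<kappa> v)" and m: "m \<in> tight \<eta> \<kappa> v"
    and d: "\<eta> m \<bullet> d = -1" "\<And>k. k \<in> tight \<eta> \<kappa> v \<Longrightarrow> k \<noteq> m \<Longrightarrow> \<eta> k \<bullet> d = 0"
  obtains t l where "t > 0" "l \<notin> tight \<eta> \<kappa> v" "v + t *\<^sub>R d \<in> polytope_of \<eta> \<kappa>"
    "rigid \<eta> (tight \<eta> \<kappa> (v + t *\<^sub>R d))" "tight \<eta> \<kappa> (v + t *\<^sub>R d) = insert l (tight \<eta> \<kappa> v - {m})"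
proof -
  note P = simple_is_polytope[OF S]
  let ?J = "{l. \<eta> l \<bullet> d > 0}"
  define r where "r = (\<lambda>l. (\<kappa> $ l - \<eta> l \<bullet> v) / (\<eta> l \<bullet> d))"
  define t where "t = Min (r ` ?J)"
  have "d \<noteq> 0" using d(1) by auto
  then have "\<exists>l. \<not> \<eta> l \<bullet> d \<le> 0" using no_recession[OF P, of d] by blast
  then have ne: "?J \<noteq> {}" by (auto simp: not_le)
  then have "t \<in> r ` ?J" unfolding t_def by (intro Min_in) auto
  then obtain l where l: "\<eta> l \<bullet> d > 0" "t = r l" by auto
  have tle: "t \<le> r j" if "\<eta> j \<bullet> d > 0" for j unfolding t_def by (rule Min_le) (use that in auto)
  have lv: "l \<notin> tight \<eta> \<kappa> v"
  proof
    assume "l \<in> tight \<eta> \<kappa> v"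
    then have "\<eta> l \<bullet> d \<le> 0" using d by (cases "l = m") auto
    then show False using l(1) by simp
  qed
  then have gap: "\<eta> l \<bullet> v < \<kappa> $ l" using v(1) by (auto simp: tight_def mem_polytope_of order_less_le)
  then have t: "t > 0" using l by (simp add: r_def)
  let ?w = "v + t *\<^sub>R d"
  have le: "\<eta> j \<bullet> ?w \<le> \<kappa> $ j" for j
  proof (cases "\<eta> j \<bullet> d > 0")
    case True
    then show ?thesis using tle[OF True] by (simp add: r_def inner_add_right field_simps)
  next
    case False
    then have "t * (\<eta> j \<bullet> d) \<le> 0" using t by (simp add: mult_nonneg_nonpos)
    moreover have "\<eta> j \<bullet> v \<le> \<kappa> $ j" using v(1) by (simp add: mem_polytope_of)
    ultimately show ?thesis by (simp add: inner_add_right)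
  qed
  then have w: "?w \<in> polytope_of \<eta> \<kappa>" by (simp add: mem_polytope_of)
  let ?T = "insert l (tight \<eta> \<kappa> v - {m})"
  have sub: "?T \<subseteq> tight \<eta> \<kappa> ?w"
  proof
    fix k assume "k \<in> ?T"
    then consider "k = l" | "k \<in> tight \<eta> \<kappa> v" "k \<noteq> m" by auto
    then show "k \<in> tight \<eta> \<kappa> ?w"
    proof cases
      case 1
      then show ?thesis using l by (simp add: tight_def inner_add_right r_def)
    next
      case 2
      then show ?thesis using d(2) by (simp add: tight_def inner_add_right)
    qed
  qed
  have rT: "rigid \<eta> ?T" unfolding rigid_def
  proof (intro allI impI)
    fix x assume x: "\<forall>k\<in>?T. \<eta> k \<bullet> x = 0"
    have "\<eta> k \<bullet> (x + (\<eta> m \<bullet> x) *\<^sub>R d) = 0" if "k \<in> tight \<eta> \<kappa> v" for k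
      using x d that by (cases "k = m") (auto simp: inner_add_right)
    then have e: "x + (\<eta> m \<bullet> x) *\<^sub>R d = 0" using v(2) unfolding rigid_def by blast
    have "\<eta> l \<bullet> (x + (\<eta> m \<bullet> x) *\<^sub>R d) = (\<eta> m \<bullet> x) * (\<eta> l \<bullet> d)" using x by (simp add: inner_add_right)
    then have "\<eta> m \<bullet> x = 0" using e l(1) by simp
    then show "x = 0" using e by simp
  qed
  have rw: "rigid \<eta> (tight \<eta> \<kappa> ?w)" by (rule rigid_mono[OF rT sub])
  have "card ?T = Suc (card (tight \<eta> \<kappa> v - {m}))" using lv by (intro card_insert_disjoint) auto
  also have "\<dots> = card (tight \<eta> \<kappa> v)" by (rule card_Suc_Diff1) (use m in auto)
  also have "\<dots> = card (tight \<eta> \<kappa> ?w)" using simpleD[OF S v] simpleD[OF S w rw] by simp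
  finally have "?T = tight \<eta> \<kappa> ?w" using card_subset_eq[OF _ sub] by simp
  then show ?thesis using that[OF t lv w rw] by simp
qed

text \<open>
  The vertices of the polytope, described by the rigidity of their tight constraints.
\<close>

definition vertices :: "('n::finite \<Rightarrow> 'a::euclidean_space) \<Rightarrow> real ^ 'n \<Rightarrow> 'a set" where
  "vertices \<eta> \<kappa> = {v \<in> polytope_of \<eta> \<kappa>. rigid \<eta> (tight \<eta> \<kappa> v)}"

lemma rigid_tight_unique:
  assumes "rigid \<eta> T" "T \<subseteq> tight \<eta> \<kappa> x" "T \<subseteq> tight \<eta> \<kappa> y"
  shows "x = y"
proof -
  have "\<forall>k\<in>T. \<eta> k \<bullet> (x - y) = 0" using assms(2,3) by (force simp: tight_def inner_diff_right)
  then have "x - y = 0" using assms(1) unfolding rigid_def by blast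
  then show ?thesis by simp
qed

lemma finite_vertices: "finite (vertices \<eta> \<kappa>)"
proof (rule inj_on_finite)
  show "inj_on (tight \<eta> \<kappa>) (vertices \<eta> \<kappa>)"
  proof (rule inj_onI)
    fix x y assume "x \<in> vertices \<eta> \<kappa>" "y \<in> vertices \<eta> \<kappa>" "tight \<eta> \<kappa> x = tight \<eta> \<kappa> y"
    then show "x = y" using rigid_tight_unique[of \<eta> "tight \<eta> \<kappa> x" \<kappa> x y] by (simp add: vertices_def)
  qed
  show "tight \<eta> \<kappa> ` vertices \<eta> \<kappa> \<subseteq> UNIV" by simp
qed simp

text \<open>
  If \<open>\<phi>\<close> is larger at some point of the facet \<open>i\<close> than at its vertex \<open>v\<close>, then it increases along an edge
  of that facet from \<open>v\<close>: the vector \<open>y - v\<close> is a nonnegative combination of the edge directions.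
\<close>

lemma improving_direction:
  fixes \<eta> :: "'n::finite \<Rightarrow> 'a::euclidean_space"
  assumes S: "simple_polytope \<eta> \<kappa>"
    and v: "v \<in> polytope_of \<eta> \<kappa>" "rigid \<eta> (tight \<eta> \<kappa> v)" 
    and y: "y \<in> polytope_of \<eta> \<kappa>" and i: "i \<in> tight \<eta> \<kappa> v" "i \<in> tight \<eta> \<kappa> y"
    and \<phi>: "\<phi> \<bullet> v < \<phi> \<bullet> y"
  obtains m d where "m \<in> tight \<eta> \<kappa> v" "m \<noteq> i" "\<eta> m \<bullet> d = -1"
    "\<And>k. k \<in> tight \<eta> \<kappa> v \<Longrightarrow> k \<noteq> m \<Longrightarrow> \<eta> k \<bullet> d = 0" "\<phi> \<bullet> d > 0"
proof -
  let ?T = "tight \<eta> \<kappa> v"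
  have "\<exists>d. \<forall>k\<in>?T. \<eta> k \<bullet> d = (if k = m then -1 else 0)" for m
    using rigid_dual[OF v(2) simpleD[OF S v], of "\<lambda>k. if k = m then -1 else 0"] by metis
  then obtain E where E: "\<And>m k. k \<in> ?T \<Longrightarrow> \<eta> k \<bullet> E m = (if k = m then -1 else 0)" by metis
  have "\<eta> k \<bullet> (y - v - (\<Sum>m\<in>?T. (\<kappa> $ m - \<eta> m \<bullet> y) *\<^sub>R E m)) = 0" if k: "k \<in> ?T" for k
  proof -
    have "\<eta> k \<bullet> (\<Sum>m\<in>?T. (\<kappa> $ m - \<eta> m \<bullet> y) *\<^sub>R E m) = (\<Sum>m\<in>?T. if k = m then - (\<kappa> $ m - \<eta> m \<bullet> y) else 0)"
      unfolding inner_sum_right by (rule sum.cong) (use E[OF k] in auto)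
    also have "\<dots> = - (\<kappa> $ k - \<eta> k \<bullet> y)" using k by simp
    finally show ?thesis using k by (simp add: inner_diff_right tight_def)
  qed
  then have "y - v - (\<Sum>m\<in>?T. (\<kappa> $ m - \<eta> m \<bullet> y) *\<^sub>R E m) = 0" using v(2) unfolding rigid_def by blast
  then have "y - v = (\<Sum>m\<in>?T. (\<kappa> $ m - \<eta> m \<bullet> y) *\<^sub>R E m)" by simp
  then have "\<phi> \<bullet> (y - v) = (\<Sum>m\<in>?T. (\<kappa> $ m - \<eta> m \<bullet> y) * (\<phi> \<bullet> E m))" by (simp add: inner_sum_right)
  moreover have "\<phi> \<bullet> (y - v) > 0" using \<phi> by (simp add: inner_diff_right)
  ultimately have "\<not> (\<Sum>m\<in>?T. (\<kappa> $ m - \<eta> m \<bullet> y) * (\<phi> \<bullet> E m)) \<le> 0" by simp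
  then obtain m where m: "m \<in> ?T" "(\<kappa> $ m - \<eta> m \<bullet> y) * (\<phi> \<bullet> E m) > 0"
    using sum_nonpos[of ?T "\<lambda>m. (\<kappa> $ m - \<eta> m \<bullet> y) * (\<phi> \<bullet> E m)"] by (meson not_less)
  have "\<kappa> $ m - \<eta> m \<bullet> y \<ge> 0" using y by (simp add: mem_polytope_of)
  then have pos: "\<kappa> $ m - \<eta> m \<bullet> y > 0" "\<phi> \<bullet> E m > 0" using m(2) by (auto simp: zero_less_mult_iff)
  have "m \<noteq> i" using pos(1) i(2) by (auto simp: tight_def)
  then show ?thesis using that[of m "E m"] m(1) E pos(2) by simp
qed

text \<open>
  All vertices of \<open>F\<^sub>i\<close> share the transverse edge direction \<open>\<zeta>\<close>.  The simplex algorithm for a functional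
  with unique maximum \<open>v0\<close> connects every vertex of \<open>F\<^sub>i\<close> to \<open>v0\<close> by edges of \<open>F\<^sub>i\<close>, and
  \<open>edge_transport\<close> moves the direction along each of them.
\<close>

lemma facet_direction_constant:
  fixes \<eta> :: "'n::finite \<Rightarrow> 'a::euclidean_space"
  assumes S: "simple_polytope \<eta> \<kappa>" and D: "slab_doubling \<eta> \<kappa> i"
    and v0: "v0 \<in> vertices \<eta> \<kappa>" "i \<in> tight \<eta> \<kappa> v0"
    and \<zeta>: "\<eta> i \<bullet> \<zeta> = -1" "\<And>k. k \<in> tight \<eta> \<kappa> v0 \<Longrightarrow> k \<noteq> i \<Longrightarrow> \<eta> k \<bullet> \<zeta> = 0"
    and v: "v \<in> vertices \<eta> \<kappa>" "i \<in> tight \<eta> \<kappa> v"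
  shows "\<forall>k\<in>tight \<eta> \<kappa> v - {i}. \<eta> k \<bullet> \<zeta> = 0"
proof -
  \<comment> \<open>Its maximum on the polytope is attained at \<open>v0\<close> only.\<close>
  define \<phi> where "\<phi> = (\<Sum>k\<in>tight \<eta> \<kappa> v0. \<eta> k)"
  define N where "N = (\<lambda>v. card {u \<in> vertices \<eta> \<kappa>. \<phi> \<bullet> v < \<phi> \<bullet> u})"
  show ?thesis using v
  proof (induction "N v" arbitrary: v rule: less_induct)
    case less
    have vP: "v \<in> polytope_of \<eta> \<kappa>" "rigid \<eta> (tight \<eta> \<kappa> v)" using less.prems by (auto simp: vertices_def)
    have v0P: "v0 \<in> polytope_of \<eta> \<kappa>" "rigid \<eta> (tight \<eta> \<kappa> v0)" using v0 by (auto simp: vertices_def)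
    show ?case
    proof (cases "v = v0")
      case True
      then show ?thesis using \<zeta>(2) by blast
    next
      case False
      have le: "\<eta> k \<bullet> v \<le> \<kappa> $ k" for k using vP(1) by (simp add: mem_polytope_of)
      have "\<not> tight \<eta> \<kappa> v0 \<subseteq> tight \<eta> \<kappa> v"
        using rigid_tight_unique[OF v0P(2) _ order_refl] False by blast
      then obtain k where k: "k \<in> tight \<eta> \<kappa> v0" "\<eta> k \<bullet> v < \<kappa> $ k"
        using le by (auto simp: tight_def order_less_le)
      have "(\<Sum>k\<in>tight \<eta> \<kappa> v0. \<eta> k \<bullet> v) < (\<Sum>k\<in>tight \<eta> \<kappa> v0. \<kappa> $ k)"
        by (rule sum_strict_mono_ex1) (use le k in auto)
      also have "\<dots> = \<phi> \<bullet> v0" unfolding \<phi>_def inner_sum_left by (rule sum.cong) (auto simp: tight_def)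
      finally have "\<phi> \<bullet> v < \<phi> \<bullet> v0" by (simp add: \<phi>_def inner_sum_left)
      from improving_direction[OF S vP v0P(1) less.prems(2) v0(2) this]
      obtain m d where md: "m \<in> tight \<eta> \<kappa> v" "m \<noteq> i" "\<eta> m \<bullet> d = -1"
        "\<And>k. k \<in> tight \<eta> \<kappa> v \<Longrightarrow> k \<noteq> m \<Longrightarrow> \<eta> k \<bullet> d = 0" "\<phi> \<bullet> d > 0" by blast
      from pivot[OF S vP md(1,3,4)] obtain t l where tl: "t > 0" "l \<notin> tight \<eta> \<kappa> v" "v + t *\<^sub>R d \<in> polytope_of \<eta> \<kappa>"
        "rigid \<eta> (tight \<eta> \<kappa> (v + t *\<^sub>R d))" "tight \<eta> \<kappa> (v + t *\<^sub>R d) = insert l (tight \<eta> \<kappa> v - {m})"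
        by blast
      let ?w = "v + t *\<^sub>R d" and ?A = "tight \<eta> \<kappa> v - {m}"
      have wV: "?w \<in> vertices \<eta> \<kappa>" using tl by (simp add: vertices_def)
      have up: "\<phi> \<bullet> v < \<phi> \<bullet> ?w" using tl(1) md(5) by (simp add: inner_add_right)
      have "N ?w < N v" unfolding N_def
      proof (rule psubset_card_mono)
        show "finite {u \<in> vertices \<eta> \<kappa>. \<phi> \<bullet> v < \<phi> \<bullet> u}"
          by (rule finite_subset[OF _ finite_vertices[of \<eta> \<kappa>]]) auto
        show "{u \<in> vertices \<eta> \<kappa>. \<phi> \<bullet> ?w < \<phi> \<bullet> u} \<subset> {u \<in> vertices \<eta> \<kappa>. \<phi> \<bullet> v < \<phi> \<bullet> u}"
        proof
          show "{u \<in> vertices \<eta> \<kappa>. \<phi> \<bullet> ?w < \<phi> \<bullet> u} \<subseteq> {u \<in> vertices \<eta> \<kappa>. \<phi> \<bullet> v < \<phi> \<bullet> u}"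
            using up by (intro Collect_mono) linarith
          have "?w \<in> {u \<in> vertices \<eta> \<kappa>. \<phi> \<bullet> v < \<phi> \<bullet> u}" using wV up by simp
          moreover have "?w \<notin> {u \<in> vertices \<eta> \<kappa>. \<phi> \<bullet> ?w < \<phi> \<bullet> u}" by simp
          ultimately show "{u \<in> vertices \<eta> \<kappa>. \<phi> \<bullet> ?w < \<phi> \<bullet> u} \<noteq> {u \<in> vertices \<eta> \<kappa>. \<phi> \<bullet> v < \<phi> \<bullet> u}" by metis
        qed
      qed
      moreover have iA: "i \<in> ?A" using less.prems(2) md(2) by simp
      then have iw: "i \<in> tight \<eta> \<kappa> ?w" unfolding tl(5) by simp
      ultimately have IH: "\<forall>k\<in>tight \<eta> \<kappa> ?w - {i}. \<eta> k \<bullet> \<zeta> = 0" using less.hyps wV by blast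
      have li: "l \<noteq> i" using tl(2) less.prems(2) by auto
      have lm: "m \<noteq> l" using md(1) tl(2) by auto
      have vT: "tight \<eta> \<kappa> v = insert m ?A" using md(1) by auto
      have lA: "l \<notin> ?A" and mA: "m \<notin> ?A" using tl(2) by auto
      have zA: "\<eta> k \<bullet> \<zeta> = 0" if "k \<in> ?A" "k \<noteq> i" for k using IH that unfolding tl(5) by simp
      have zl: "\<eta> l \<bullet> \<zeta> = 0" using IH li unfolding tl(5) by simp
      have "\<eta> m \<bullet> \<zeta> = 0"
        by (rule edge_transport[OF S D tl(3,4,5) lA vP vT mA lm iA \<zeta>(1) zA zl])
      then show ?thesis using zA by auto
    qed
  qed
qed

text \<open>
  The facet \<open>F\<^sub>i\<close> is flat: the conormals of the other facets meeting it lie in one hyperplane, the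
  orthogonal complement of a \<open>\<zeta>\<close> transverse to \<open>F\<^sub>i\<close>.
\<close>

lemma flat_facet:
  fixes \<eta> :: "'n::finite \<Rightarrow> 'a::euclidean_space"
  assumes S: "simple_polytope \<eta> \<kappa>" and D: "slab_doubling \<eta> \<kappa> i"
  obtains \<zeta> where "\<eta> i \<bullet> \<zeta> = -1" "\<And>k. k \<noteq> i \<Longrightarrow> facet \<eta> \<kappa> i \<inter> facet \<eta> \<kappa> k \<noteq> {} \<Longrightarrow> \<eta> k \<bullet> \<zeta> = 0"
proof -
  note P = simple_is_polytope[OF S]
  have vert: "\<exists>v\<in>vertices \<eta> \<kappa>. {i, k} \<subseteq> tight \<eta> \<kappa> v" if "x \<in> facet \<eta> \<kappa> i" "x \<in> facet \<eta> \<kappa> k" for x k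
  proof -
    have "x \<in> polytope_of \<eta> \<kappa>" "{i, k} \<subseteq> tight \<eta> \<kappa> x" using that by (auto simp: mem_facet)
    from face_vertex[OF P this] obtain v where "v \<in> polytope_of \<eta> \<kappa>" "rigid \<eta> (tight \<eta> \<kappa> v)" "{i, k} \<subseteq> tight \<eta> \<kappa> v"
      by blast
    then show ?thesis unfolding vertices_def by blast
  qed
  obtain x where "x \<in> facet \<eta> \<kappa> i" using facet_nonempty[OF P] by blast
  from vert[OF this this] obtain v0 where v0: "v0 \<in> vertices \<eta> \<kappa>" "i \<in> tight \<eta> \<kappa> v0" by blast
  then have v0P: "v0 \<in> polytope_of \<eta> \<kappa>" "rigid \<eta> (tight \<eta> \<kappa> v0)" by (auto simp: vertices_def)
  obtain \<zeta> where z: "\<And>k. k \<in> tight \<eta> \<kappa> v0 \<Longrightarrow> \<eta> k \<bullet> \<zeta> = (if k = i then -1 else 0)"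
    using rigid_dual[OF v0P(2) simpleD[OF S v0P], of "\<lambda>k. if k = i then -1 else 0"] by blast
  have zi: "\<eta> i \<bullet> \<zeta> = -1" using z[OF v0(2)] by simp
  have z0: "\<eta> k \<bullet> \<zeta> = 0" if "k \<in> tight \<eta> \<kappa> v0" "k \<noteq> i" for k using z that by simp
  have "\<eta> k \<bullet> \<zeta> = 0" if k: "k \<noteq> i" "facet \<eta> \<kappa> i \<inter> facet \<eta> \<kappa> k \<noteq> {}" for k
  proof -
    obtain x where "x \<in> facet \<eta> \<kappa> i" "x \<in> facet \<eta> \<kappa> k" using k by blast
    from vert[OF this] obtain v where v: "v \<in> vertices \<eta> \<kappa>" "{i, k} \<subseteq> tight \<eta> \<kappa> v" by blast
    then have "i \<in> tight \<eta> \<kappa> v" by simp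
    from facet_direction_constant[OF S D v0 zi z0 v(1) this] show ?thesis using v(2) k(1) by blast
  qed
  then show ?thesis using that zi by blast
qed

section \<open>Reflections and the center of mass\<close>

lemma lborel_distr_reflect: "distr lborel borel (\<lambda>x. t - x) = (lborel :: 'a::euclidean_space measure)"
  using lborel_affine[of "-1" t] by (simp add: density_1)

text \<open>
  Uniqueness of Haar measure in the case needed.  With \<open>\<nu>\<close> the image of Lebesgue measure \<open>\<lambda>\<close> under \<open>L\<close>,
  Fubini and the substitution \<open>y \<mapsto> x - y\<close> give \<open>\<nu>(A) * \<lambda>(B) = \<nu>(B) * \<lambda>(A)\<close>, so \<open>\<nu>\<close> is a multiple of
  \<open>\<lambda>\<close>; as \<open>L\<close> is an involution, the factor has square \<open>1\<close>.
\<close>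

lemma linear_involution_lborel:
  fixes L :: "'a::euclidean_space \<Rightarrow> 'a"
  assumes lin: "linear L" and inv: "\<And>x. L (L x) = x"
  shows "distr lborel borel L = lborel"
proof -
  have mL [measurable]: "L \<in> borel_measurable borel"
    using lin by (intro borel_measurable_continuous_onI linear_continuous_on) (simp add: linear_conv_bounded_linear)
  define \<nu> where "\<nu> = distr lborel borel L"
  have nu: "emeasure \<nu> A = (\<integral>\<^sup>+y. indicator A (L y) \<partial>lborel)" if [measurable]: "A \<in> sets borel" for A
  proof -
    have "emeasure \<nu> A = (\<integral>\<^sup>+y. indicator A y \<partial>\<nu>)" by (simp add: \<nu>_def)
    also have "\<dots> = (\<integral>\<^sup>+y. indicator A (L y) \<partial>lborel)" unfolding \<nu>_def by (subst nn_integral_distr) auto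
    finally show ?thesis .
  qed
  define J where "J = (\<lambda>A B. \<integral>\<^sup>+x. \<integral>\<^sup>+y. indicator A (L y) * indicator B (x - L y) \<partial>lborel \<partial>(lborel :: 'a measure) :: ennreal)"
  have J1: "emeasure \<nu> A * emeasure lborel B = J A B" if [measurable]: "A \<in> sets borel" "B \<in> sets borel" for A B
  proof -
    have tr: "(\<integral>\<^sup>+x. indicator B (x - L y) \<partial>lborel) = emeasure lborel B" for y
    proof -
      have "emeasure lborel B = (\<integral>\<^sup>+x. indicator B x \<partial>distr lborel borel ((+) (- L y)))"
        by (simp add: lborel_distr_plus)
      also have "\<dots> = (\<integral>\<^sup>+x. indicator B (x - L y) \<partial>lborel)" by (subst nn_integral_distr) auto
      finally show ?thesis by simp
    qed
    have "emeasure \<nu> A * emeasure lborel B = (\<integral>\<^sup>+y. indicator A (L y) * emeasure lborel B \<partial>lborel)"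
      by (subst nn_integral_multc) (auto simp: nu)
    also have "\<dots> = (\<integral>\<^sup>+y. \<integral>\<^sup>+x. indicator A (L y) * indicator B (x - L y) \<partial>lborel \<partial>lborel)"
      by (intro nn_integral_cong, subst nn_integral_cmult) (auto simp: tr)
    also have "\<dots> = J A B" unfolding J_def
      by (rule lborel_pair.Fubini'[where f = "\<lambda>x y. indicator A (L y) * indicator B (x - L y)"]) measurable
    finally show ?thesis .
  qed
  have J2: "J A B = J B A" if [measurable]: "A \<in> sets borel" "B \<in> sets borel" for A B
    unfolding J_def
  proof (rule nn_integral_cong)
    fix x
    have "(\<integral>\<^sup>+y. indicator A (L y) * indicator B (x - L y) \<partial>lborel) =
      (\<integral>\<^sup>+y. indicator A (L y) * indicator B (x - L y) \<partial>distr lborel borel (\<lambda>y. L x - y))"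
      by (simp add: lborel_distr_reflect)
    also have "\<dots> = (\<integral>\<^sup>+y. indicator A (L (L x - y)) * indicator B (x - L (L x - y)) \<partial>lborel)"
      by (subst nn_integral_distr) auto
    also have "\<dots> = (\<integral>\<^sup>+y. indicator B (L y) * indicator A (x - L y) \<partial>lborel)"
      by (simp add: linear_diff[OF lin] inv mult.commute)
    finally show "(\<integral>\<^sup>+y. indicator A (L y) * indicator B (x - L y) \<partial>lborel) =
      (\<integral>\<^sup>+y. indicator B (L y) * indicator A (x - L y) \<partial>lborel)" .
  qed
  have key: "emeasure \<nu> A * emeasure lborel B = emeasure \<nu> B * emeasure lborel A"
    if "A \<in> sets borel" "B \<in> sets borel" for A B
    using J1[OF that] J1[OF that(2,1)] J2[OF that] by simp
  define B where "B = ball (0::'a) 1"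
  define B' where "B' = L -` B"
  have B[measurable]: "B \<in> sets borel" by (simp add: B_def)
  have B'[measurable]: "B' \<in> sets borel" unfolding B'_def using measurable_sets[OF mL B] by simp
  have nu': "emeasure \<nu> A = emeasure lborel (L -` A)" if "A \<in> sets borel" for A
    unfolding \<nu>_def by (subst emeasure_distr) (use that in auto)
  have "L -` B' = B" by (auto simp: B'_def inv)
  then have "emeasure \<nu> B' = emeasure lborel B" using nu'[OF B'] by simp
  moreover have "emeasure \<nu> B = emeasure lborel B'" using nu'[OF B] by (simp add: B'_def)
  ultimately have sq: "emeasure \<nu> B * emeasure \<nu> B = emeasure lborel B * emeasure lborel B"
    using key[OF B B'] by simp
  have fin: "emeasure lborel B < \<infinity>" unfolding B_def by (rule emeasure_lborel_ball_finite)
  have ne0: "emeasure lborel B \<noteq> 0"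
  proof
    assume "emeasure lborel B = 0"
    then have "B \<in> null_sets lborel" by (simp add: null_sets_def)
    then have "negligible B" by (simp add: negligible_iff_null_sets null_sets_completionI)
    then show False using open_not_negligible[of B] by (simp add: B_def)
  qed
  have eqB: "emeasure \<nu> B = emeasure lborel B"
  proof -
    have "emeasure \<nu> B \<noteq> \<infinity>"
    proof
      assume "emeasure \<nu> B = \<infinity>"
      then have "emeasure lborel B * emeasure lborel B = \<infinity>" using sq by simp
      then show False using fin by (auto simp: ennreal_mult_eq_top_iff)
    qed
    then obtain c where c: "emeasure \<nu> B = ennreal c" "c \<ge> 0" by (cases "emeasure \<nu> B") auto
    obtain b where b: "emeasure lborel B = ennreal b" "b \<ge> 0" using fin by (cases "emeasure lborel B") auto
    have "c * c = b * b" using sq b c by (simp flip: ennreal_mult)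
    then have "c = b" using b(2) c(2) by (metis abs_of_nonneg real_sqrt_abs2)
    then show ?thesis using b c by simp
  qed
  have "emeasure \<nu> A = emeasure lborel A" if "A \<in> sets borel" for A
  proof -
    have "emeasure lborel B * emeasure \<nu> A = emeasure lborel B * emeasure lborel A"
      using key[OF that B] eqB by (simp add: mult.commute)
    then show ?thesis using fin ne0 by (auto simp: ennreal_mult_cancel_left)
  qed
  then have "\<nu> = lborel" by (intro measure_eqI) (auto simp: \<nu>_def)
  then show ?thesis by (simp add: \<nu>_def)
qed

text \<open>
  The affine map fixing the hyperplane \<open>f \<bullet> x = d\<close> pointwise and moving points along \<open>\<zeta>\<close>.  It is an
  involution, in general not orthogonal, when \<open>f \<bullet> \<zeta> = -2\<close>; its linear part is the case \<open>d = 0\<close>.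
\<close>

definition reflection :: "'a::euclidean_space \<Rightarrow> real \<Rightarrow> 'a \<Rightarrow> 'a \<Rightarrow> 'a" where
  "reflection f d \<zeta> x = x + (f \<bullet> x - d) *\<^sub>R \<zeta>"

lemma reflection_odd: "f \<bullet> \<zeta> = -2 \<Longrightarrow> f \<bullet> reflection f d \<zeta> x - d = - (f \<bullet> x - d)"
  by (simp add: reflection_def inner_add_right algebra_simps)

lemma reflection_involution: "f \<bullet> \<zeta> = -2 \<Longrightarrow> reflection f d \<zeta> (reflection f d \<zeta> x) = x"
  using reflection_odd[of f \<zeta> d x]
  by (simp add: reflection_def[of f d \<zeta> "reflection f d \<zeta> x"])
    (simp add: reflection_def flip: scaleR_left_distrib)

lemma linear_reflection: "linear (reflection f 0 \<zeta>)"
  by (rule linearI) (simp_all add: reflection_def inner_add_right algebra_simps)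

lemma reflection_affine: "reflection f d \<zeta> x = reflection f 0 \<zeta> x + (- d) *\<^sub>R \<zeta>"
  by (simp add: reflection_def algebra_simps)

lemma reflection_lborel:
  assumes "f \<bullet> \<zeta> = -2" shows "distr lborel borel (reflection f d \<zeta>) = lborel"
proof -
  have mL [measurable]: "reflection f 0 \<zeta> \<in> borel_measurable borel"
    using linear_reflection 
    by (intro borel_measurable_continuous_onI linear_continuous_on) (simp add: linear_conv_bounded_linear)
  have "distr lborel borel (reflection f d \<zeta>) = distr (distr lborel borel (reflection f 0 \<zeta>)) borel ((+) ((- d) *\<^sub>R \<zeta>))"
  proof -
    have "reflection f d \<zeta> = (+) ((- d) *\<^sub>R \<zeta>) \<circ> reflection f 0 \<zeta>"
      by (rule ext) (simp add: reflection_def algebra_simps)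
    then show ?thesis by (subst distr_distr) auto
  qed
  also have "\<dots> = lborel"
    by (simp add: linear_involution_lborel[OF linear_reflection reflection_involution[OF assms]] lborel_distr_plus)
  finally show ?thesis .
qed

text \<open>
  The function \<open>f \<bullet> x - d\<close> changes sign under the reflection, which preserves Lebesgue measure, so its
  integral over an invariant polytope vanishes.
\<close>

lemma center_of_reflection_symmetric:
  fixes \<eta> :: "'n::finite \<Rightarrow> 'a::euclidean_space"
  assumes P: "is_polytope \<eta> \<kappa>" and f: "f \<bullet> \<zeta> = -2"
    and sym: "\<And>x. x \<in> polytope_of \<eta> \<kappa> \<Longrightarrow> reflection f d \<zeta> x \<in> polytope_of \<eta> \<kappa>"
  shows "f \<bullet> center_of_mass (polytope_of \<eta> \<kappa>) = d"
proof -
  let ?P = "polytope_of \<eta> \<kappa>" and ?g = "\<lambda>x. f \<bullet> x - d" and ?a = "reflection f d \<zeta>"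
  have cg: "continuous_on UNIV ?g" by (intro continuous_intros)
  have si: "set_integrable lborel ?P ?g" unfolding set_integrable_def
    by (rule borel_integrable_compact[OF compact_polytope_of[OF P]]) (rule continuous_on_subset[OF cg], simp)
  have ma: "?a \<in> borel_measurable borel" unfolding reflection_def
    by (intro borel_measurable_continuous_onI continuous_intros)
  have iff: "?a x \<in> ?P \<longleftrightarrow> x \<in> ?P" for x using sym[of x] sym[of "?a x"] reflection_involution[OF f] by auto
  have "(LINT x:?P|lborel. ?g x) = (LINT x|distr lborel borel ?a. indicator ?P x *\<^sub>R ?g x)"
    by (simp add: reflection_lborel[OF f] set_lebesgue_integral_def)
  also have "\<dots> = (LINT x|lborel. indicator ?P (?a x) *\<^sub>R ?g (?a x))"
    by (rule integral_distr) (use ma closed_polytope_of[of \<eta> \<kappa>] in \<open>auto intro!: borel_measurable_continuous_onI continuous_intros\<close>)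
  also have "\<dots> = (LINT x|lborel. - (indicator ?P x *\<^sub>R ?g x))"
    by (rule Bochner_Integration.integral_cong) (auto simp: reflection_odd[OF f] iff indicator_def)
  also have "\<dots> = - (LINT x:?P|lborel. ?g x)" by (simp add: set_lebesgue_integral_def)
  finally have "(LINT x:?P|lborel. ?g x) = 0" by simp
  then have "integral ?P ?g = 0" using set_borel_integral_eq_integral(2)[OF si] by simp
  moreover have "integral ?P ?g = integral ?P (\<lambda>x. f \<bullet> x) - integral ?P (\<lambda>x. d)"
    by (rule Henstock_Kurzweil_Integration.integral_diff) (intro integrable_polytope[OF P] continuous_intros)+
  moreover have "integral ?P (\<lambda>x. f \<bullet> x) = f \<bullet> integral ?P (\<lambda>x. x)"
    using integral_linear[OF integrable_polytope[OF P continuous_on_id] bounded_linear_inner_right[of f]]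
    by (simp add: o_def)
  moreover have "integral ?P (\<lambda>x. d) = d * vol \<eta> \<kappa>"
  proof -
    have "integral ?P (\<lambda>x. d * 1) = d * integral ?P (\<lambda>x. 1)" by (rule Henstock_Kurzweil_Integration.integral_mult_right)
    then show ?thesis using lmeasure_integral[OF lmeasurable_polytope[OF P]] by simp
  qed
  ultimately have "f \<bullet> integral ?P (\<lambda>x. x) = d * vol \<eta> \<kappa>" by simp
  then show ?thesis using vol_pos[OF P] by (simp add: center_of_mass_def)
qed

section \<open>Equivalent facets and inessential functions\<close>

text \<open>
  The coefficients are determined by \<open>H\<close> because the chamber contains a neighbourhood of \<open>\<kappa>\<close>.
\<close>

lemma symmetric_facet_iff_coeff:
  assumes S: "simple_polytope \<eta> \<kappa>" and m: "mass_coeffs \<eta> \<kappa> H \<gamma> C"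
  shows "symmetric_facet \<eta> \<kappa> H i \<longleftrightarrow> \<gamma> i = 0"
proof
  assume sym: "symmetric_facet \<eta> \<kappa> H i"
  obtain e where e: "e > 0" and ch: "\<And>\<kappa>'. (\<And>k. \<bar>\<kappa>' $ k - \<kappa> $ k\<bar> \<le> e) \<Longrightarrow> \<kappa>' \<in> chamber \<eta> \<kappa>"
    using nhds_box[OF chamber_near[OF S]] by blast
  let ?k = "\<kappa> - e *\<^sub>R axis i 1"
  have c: "\<kappa> \<in> chamber \<eta> \<kappa>" "?k \<in> chamber \<eta> \<kappa>"
    by (rule ch, use e in \<open>simp add: axis_def\<close>)+
  have "\<forall>j. j \<noteq> i \<longrightarrow> \<kappa> $ j = ?k $ j" unfolding dec_nth by simp
  then have "H \<bullet> center_of_mass (polytope_of \<eta> \<kappa>) = H \<bullet> center_of_mass (polytope_of \<eta> ?k)"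
    using sym c unfolding symmetric_facet_def by blast
  then have "(\<Sum>i\<in>UNIV. \<gamma> i * \<kappa> $ i) + C = (\<Sum>j\<in>UNIV. \<gamma> j * ?k $ j) + C"
    using m c unfolding mass_coeffs_def by metis
  then show "\<gamma> i = 0" unfolding sum_dec using e by simp
next
  assume z: "\<gamma> i = 0"
  show "symmetric_facet \<eta> \<kappa> H i" unfolding symmetric_facet_def
  proof (intro ballI impI)
    fix k1 k2 assume k: "k1 \<in> chamber \<eta> \<kappa>" "k2 \<in> chamber \<eta> \<kappa>" "\<forall>j. j \<noteq> i \<longrightarrow> k1 $ j = k2 $ j"
    have "(\<Sum>i\<in>UNIV. \<gamma> i * k1 $ i) = (\<Sum>i\<in>UNIV. \<gamma> i * k2 $ i)"
    proof (rule sum.cong)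
      fix j show "\<gamma> j * k1 $ j = \<gamma> j * k2 $ j" using k(3) z by (cases "j = i") auto
    qed simp
    then show "H \<bullet> center_of_mass (polytope_of \<eta> k1) = H \<bullet> center_of_mass (polytope_of \<eta> k2)"
      using m k unfolding mass_coeffs_def by metis
  qed
qed

lemma equivalent_facets_trans:
  assumes "equivalent_facets \<eta> \<kappa> i j" "equivalent_facets \<eta> \<kappa> j k"
  shows "equivalent_facets \<eta> \<kappa> i k"
proof -
  obtain L a where 1: "robust_symmetry_via \<eta> \<kappa> L a" "\<And>\<kappa>'. \<kappa>' \<in> chamber \<eta> \<kappa> \<Longrightarrow> a \<kappa>' ` facet \<eta> \<kappa>' i = facet \<eta> \<kappa>' j"
    using assms(1) unfolding equivalent_facets_def by blast
  obtain M b where 2: "robust_symmetry_via \<eta> \<kappa> M b" "\<And>\<kappa>'. \<kappa>' \<in> chamber \<eta> \<kappa> \<Longrightarrow> b \<kappa>' ` facet \<eta> \<kappa>' j = facet \<eta> \<kappa>' k"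
    using assms(2) unfolding equivalent_facets_def by blast
  have "affine_map_with_linear_part (g \<circ> f) (M \<circ> L)"
    if aff: "affine_map_with_linear_part f L" "affine_map_with_linear_part g M" for f g
  proof -
    obtain s where s: "linear L" "\<forall>x. f x = L x + s" using aff(1) unfolding affine_map_with_linear_part_def by blast
    obtain t where t: "linear M" "\<forall>x. g x = M x + t" using aff(2) unfolding affine_map_with_linear_part_def by blast
    have "(g \<circ> f) x = (M \<circ> L) x + (M s + t)" for x using s t by (simp add: linear_add)
    then show ?thesis using linear_compose[OF s(1) t(1)] unfolding affine_map_with_linear_part_def by blast
  qed
  moreover have "linear (M \<circ> L)" using linear_compose 1(1) 2(1) unfolding robust_symmetry_via_def by blast
  moreover have "(b \<kappa>' \<circ> a \<kappa>') ` polytope_of \<eta> \<kappa>' = polytope_of \<eta> \<kappa>'" if "\<kappa>' \<in> chamber \<eta> \<kappa>" for \<kappa>'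
  proof -
    have "a \<kappa>' ` polytope_of \<eta> \<kappa>' = polytope_of \<eta> \<kappa>'" "b \<kappa>' ` polytope_of \<eta> \<kappa>' = polytope_of \<eta> \<kappa>'"
      using 1(1) 2(1) that unfolding robust_symmetry_via_def symmetry_of_def by blast+
    then show ?thesis by (simp only: image_comp[symmetric])
  qed
  ultimately have "robust_symmetry_via \<eta> \<kappa> (M \<circ> L) (\<lambda>\<kappa>'. b \<kappa>' \<circ> a \<kappa>')"
    using 1(1) 2(1) unfolding robust_symmetry_via_def symmetry_of_def by blast
  moreover have "(b \<kappa>' \<circ> a \<kappa>') ` facet \<eta> \<kappa>' i = facet \<eta> \<kappa>' k" if "\<kappa>' \<in> chamber \<eta> \<kappa>" for \<kappa>'
    using 1(2)[OF that] 2(2)[OF that] by (simp only: image_comp[symmetric])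
  ultimately show ?thesis unfolding equivalent_facets_def
    by (intro exI[of _ "M \<circ> L"] exI[of _ "\<lambda>\<kappa>'. b \<kappa>' \<circ> a \<kappa>'"]) simp
qed

lemma adjoint_reflection:
  fixes f \<zeta> :: "'a::euclidean_space"
  shows "adjoint (reflection f 0 \<zeta>) = reflection \<zeta> 0 f"
  by (rule adjoint_unique) (simp add: reflection_def inner_add_left inner_add_right inner_commute)

text \<open>
  If a direction \<open>\<zeta>\<close> is orthogonal to all conormals but \<open>\<eta> i\<close> and \<open>\<eta> j\<close>, with which its pairings have
  opposite signs, then for all support numbers a reflection along \<open>\<zeta>\<close> preserves the
  polytope and interchanges the facets \<open>i\<close> and \<open>j\<close>.
\<close>

lemma reflection_swaps:
  fixes \<eta> :: "'n::finite \<Rightarrow> 'a::euclidean_space"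
  assumes ij: "i \<noteq> j" and z: "\<eta> i \<bullet> \<zeta> = -1" "\<eta> j \<bullet> \<zeta> = t" "t > 0"
    "\<And>k. k \<noteq> i \<Longrightarrow> k \<noteq> j \<Longrightarrow> \<eta> k \<bullet> \<zeta> = 0"
  defines "f \<equiv> \<eta> i - (1 / t) *\<^sub>R \<eta> j" and "d \<equiv> \<lambda>\<kappa>. \<kappa> $ i - (1 / t) * \<kappa> $ j"
  shows "f \<bullet> \<zeta> = -2"
    and "x \<in> polytope_of \<eta> \<kappa> \<Longrightarrow> reflection f (d \<kappa>) \<zeta> x \<in> polytope_of \<eta> \<kappa>"
    and "reflection f (d \<kappa>) \<zeta> ` polytope_of \<eta> \<kappa> = polytope_of \<eta> \<kappa>"
    and "reflection f (d \<kappa>) \<zeta> ` facet \<eta> \<kappa> i = facet \<eta> \<kappa> j"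
    and "reflection f (d \<kappa>) \<zeta> ` facet \<eta> \<kappa> j = facet \<eta> \<kappa> i"
proof -
  show f: "f \<bullet> \<zeta> = -2" using z by (simp add: f_def inner_diff_left)
  let ?a = "reflection f (d \<kappa>) \<zeta>"
  have ai: "\<eta> i \<bullet> ?a y = \<kappa> $ i + (1 / t) * (\<eta> j \<bullet> y - \<kappa> $ j)" for y
    using z(1) by (simp add: reflection_def f_def d_def inner_add_right inner_diff_left algebra_simps)
  have aj: "\<eta> j \<bullet> ?a y = \<kappa> $ j + t * (\<eta> i \<bullet> y - \<kappa> $ i)" for y
    using z(2,3) by (simp add: reflection_def f_def d_def inner_add_right inner_diff_left field_simps)
  have ak: "\<eta> k \<bullet> ?a y = \<eta> k \<bullet> y" if "k \<noteq> i" "k \<noteq> j" for k y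
    using z(4)[OF that] by (simp add: reflection_def inner_add_right)
  have inv: "?a (?a y) = y" for y by (rule reflection_involution[OF f])
  have P: "?a y \<in> polytope_of \<eta> \<kappa>" if y: "y \<in> polytope_of \<eta> \<kappa>" for y
    unfolding mem_polytope_of
  proof
    fix k
    have le: "\<eta> k \<bullet> y \<le> \<kappa> $ k" for k using y by (simp add: mem_polytope_of)
    consider "k = i" | "k = j" | "k \<noteq> i" "k \<noteq> j" by blast
    then show "\<eta> k \<bullet> ?a y \<le> \<kappa> $ k"
    proof cases
      case 1
      then show ?thesis using le[of j] z(3) by (simp add: ai divide_le_0_iff)
    next
      case 2
      then show ?thesis using le[of i] z(3) by (simp add: aj mult_nonneg_nonpos)
    next
      case 3
      then show ?thesis using le by (simp add: ak)
    qed
  qed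
  then show "x \<in> polytope_of \<eta> \<kappa> \<Longrightarrow> ?a x \<in> polytope_of \<eta> \<kappa>" .
  have im: "?a ` A = B" if "\<And>y. y \<in> A \<Longrightarrow> ?a y \<in> B" "\<And>y. y \<in> B \<Longrightarrow> ?a y \<in> A" for A B
    using that inv by (metis image_subsetI rev_image_eqI subsetI subset_antisym)
  show "?a ` polytope_of \<eta> \<kappa> = polytope_of \<eta> \<kappa>" by (rule im) (rule P, assumption)+
  have ij': "?a y \<in> facet \<eta> \<kappa> j" if "y \<in> facet \<eta> \<kappa> i" for y
    using that P by (simp add: facet_def aj)
  have ji': "?a y \<in> facet \<eta> \<kappa> i" if "y \<in> facet \<eta> \<kappa> j" for y
    using that P by (simp add: facet_def ai)
  show "?a ` facet \<eta> \<kappa> i = facet \<eta> \<kappa> j" "?a ` facet \<eta> \<kappa> j = facet \<eta> \<kappa> i"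
    using im ij' ji' by blast+
qed

text \<open>
  Distinct facets of a simple polytope have conormals on distinct rays.
\<close>

lemma parallel_facets:
  fixes \<eta> :: "'n::finite \<Rightarrow> 'a::euclidean_space"
  assumes S: "simple_polytope \<eta> \<kappa>" and c: "c > 0" "\<eta> m = c *\<^sub>R \<eta> j"
  shows "m = j"
proof (rule ccontr)
  assume ne: "m \<noteq> j"
  obtain x where x: "\<eta> j \<bullet> x = \<kappa> $ j" "\<And>k. k \<noteq> j \<Longrightarrow> \<eta> k \<bullet> x < \<kappa> $ k"
    using facet_interior_point[OF S, of j] by blast
  obtain y where y: "\<eta> m \<bullet> y = \<kappa> $ m" "\<And>k. k \<noteq> m \<Longrightarrow> \<eta> k \<bullet> y < \<kappa> $ k"
    using facet_interior_point[OF S, of m] by blast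
  have "c * \<kappa> $ j < \<kappa> $ m" using x(1) x(2)[OF ne] c(2) by simp
  moreover have "\<kappa> $ m = c * (\<eta> j \<bullet> y)" using y(1) c(2) by simp
  moreover have "c * (\<eta> j \<bullet> y) < c * \<kappa> $ j" using y(2)[of j] ne c(1) by simp
  ultimately show False by simp
qed

text \<open>
  A facet \<open>F\<^sub>i\<close> with nonzero coefficient and a facet \<open>F\<^sub>j\<close> disjoint from it are interchanged by a robust
  symmetry, and \<open>\<eta> i - \<eta> j\<close> is mass linear with coefficients \<open>1\<close> at \<open>i\<close> and \<open>-1\<close> at \<open>j\<close>.
\<close>

lemma disjoint_asymmetric_pair:
  fixes \<eta> :: "'n::finite \<Rightarrow> 'a::euclidean_space"
  assumes S: "simple_polytope \<eta> \<kappa>" and N: "normalized_conormals \<eta> \<kappa>" and m: "mass_coeffs \<eta> \<kappa> H \<gamma> C"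
    and ij: "i \<noteq> j" and d: "facet \<eta> \<kappa> i \<inter> facet \<eta> \<kappa> j = {}" and nz: "\<gamma> i \<noteq> 0"
  shows "equivalent_facets \<eta> \<kappa> i j" "equivalent_facets \<eta> \<kappa> j i"
    and "\<And>\<kappa>'. \<kappa>' \<in> chamber \<eta> \<kappa> \<Longrightarrow> (\<eta> i - \<eta> j) \<bullet> center_of_mass (polytope_of \<eta> \<kappa>') = \<kappa>' $ i - \<kappa>' $ j"
proof -
  note P = simple_is_polytope[OF S]
  have D: "slab_doubling \<eta> \<kappa> i" unfolding slab_doubling_def by (rule slab_linear[OF S m ij d nz])
  obtain \<zeta> where zi: "\<eta> i \<bullet> \<zeta> = -1" and z0: "\<And>k. k \<noteq> i \<Longrightarrow> facet \<eta> \<kappa> i \<inter> facet \<eta> \<kappa> k \<noteq> {} \<Longrightarrow> \<eta> k \<bullet> \<zeta> = 0"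
    using flat_facet[OF S D] by blast
  have zk: "\<eta> k \<bullet> \<zeta> = 0" if "k \<noteq> i" "k \<noteq> j" for k
    by (rule z0[OF that(1) meets_all_others[OF S m ij d nz that]])
  define t where "t = \<eta> j \<bullet> \<zeta>"
  \<comment> \<open>Otherwise \<open>\<zeta>\<close> would be a recession direction of the bounded polytope.\<close>
  have t: "t > 0"
  proof (rule ccontr)
    assume "\<not> t > 0"
    have "\<eta> k \<bullet> \<zeta> \<le> 0" for k
    proof -
      consider "k = i" | "k = j" | "k \<noteq> i" "k \<noteq> j" by blast
      then show ?thesis by cases (use zi zk \<open>\<not> t > 0\<close> in \<open>auto simp: t_def\<close>)
    qed
    then have "\<zeta> = 0" by (rule no_recession[OF P])
    then show False using zi by simp
  qed
  let ?f = "\<eta> i - (1 / t) *\<^sub>R \<eta> j" and ?d = "\<lambda>\<kappa>'. \<kappa>' $ i - (1 / t) * \<kappa>' $ j"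
  let ?L = "reflection ?f 0 \<zeta>" and ?a = "\<lambda>\<kappa>'. reflection ?f (?d \<kappa>') \<zeta>"
  note R = reflection_swaps[where \<eta> = \<eta>, OF ij zi t_def[symmetric] t zk]
  have via: "robust_symmetry_via \<eta> \<kappa> ?L ?a"
  proof -
    have "affine_map_with_linear_part (?a \<kappa>') ?L" for \<kappa>'
      unfolding affine_map_with_linear_part_def using linear_reflection reflection_affine by blast
    then show ?thesis
      unfolding robust_symmetry_via_def symmetry_of_def using linear_reflection R(3) by blast
  qed
  show "equivalent_facets \<eta> \<kappa> i j" "equivalent_facets \<eta> \<kappa> j i"
    unfolding equivalent_facets_def using via R(4,5) by blast+
  have "adjoint ?L (\<eta> i) = (1 / t) *\<^sub>R \<eta> j"
    using zi by (simp add: adjoint_reflection reflection_def inner_commute)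
  moreover have "robust_symmetry \<eta> \<kappa> ?L" using via unfolding robust_symmetry_def by blast
  ultimately obtain l where l: "\<eta> l = (1 / t) *\<^sub>R \<eta> j"
    using N unfolding normalized_conormals_def by metis
  then have "l = j" using parallel_facets[OF S _ l] t by simp
  \<comment> \<open>The normalization of the conormals forces \<open>t = 1\<close>.\<close>
  then have "(1 - 1 / t) *\<^sub>R \<eta> j = 0" using l by (simp add: scaleR_left_diff_distrib)
  then have t1: "t = 1" using conormal_nonzero[OF P, of j] by simp
  fix \<kappa>' assume "\<kappa>' \<in> chamber \<eta> \<kappa>"
  then have "is_polytope \<eta> \<kappa>'" by (intro simple_is_polytope chamber_simple)
  from center_of_reflection_symmetric[OF this R(1,2)]
  show "(\<eta> i - \<eta> j) \<bullet> center_of_mass (polytope_of \<eta> \<kappa>') = \<kappa>' $ i - \<kappa>' $ j"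
    by (simp add: t1)
qed

lemma inessential_add:
  assumes "inessential \<eta> \<kappa> H1" "inessential \<eta> \<kappa> H2"
  shows "inessential \<eta> \<kappa> (H1 + H2)"
proof -
  obtain b1 b2 where "H1 = (\<Sum>i\<in>UNIV. b1 i *\<^sub>R \<eta> i)" "\<forall>I\<in>facet_classes \<eta> \<kappa>. sum b1 I = 0"
    "H2 = (\<Sum>i\<in>UNIV. b2 i *\<^sub>R \<eta> i)" "\<forall>I\<in>facet_classes \<eta> \<kappa>. sum b2 I = 0"
    using assms unfolding inessential_def by blast
  then show ?thesis unfolding inessential_def
    by (intro exI[of _ "\<lambda>i. b1 i + b2 i"]) (simp add: scaleR_left_distrib sum.distrib)
qed

lemma inessential_difference:
  assumes ij: "i \<noteq> j" and e: "equivalent_facets \<eta> \<kappa> i j" "equivalent_facets \<eta> \<kappa> j i"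
  shows "inessential \<eta> \<kappa> (g *\<^sub>R (\<eta> i - \<eta> j))"
proof -
  define \<beta> where "\<beta> = (\<lambda>k. (if k = i then g else 0) - (if k = j then g else 0))"
  have "g *\<^sub>R (\<eta> i - \<eta> j) = (\<Sum>k\<in>UNIV. (if k = i then g *\<^sub>R \<eta> i else 0) - (if k = j then g *\<^sub>R \<eta> j else 0))"
    by (simp add: sum_subtractf scaleR_right_diff_distrib)
  also have "\<dots> = (\<Sum>k\<in>UNIV. \<beta> k *\<^sub>R \<eta> k)"
    by (rule sum.cong) (auto simp: \<beta>_def)
  finally have H: "g *\<^sub>R (\<eta> i - \<eta> j) = (\<Sum>k\<in>UNIV. \<beta> k *\<^sub>R \<eta> k)" .
  have "sum \<beta> I = 0" if cls: "I \<in> facet_classes \<eta> \<kappa>" for I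
  proof -
    obtain x where "I = {(k, l). equivalent_facets \<eta> \<kappa> k l} `` {x}"
      using cls unfolding facet_classes_def by (rule quotientE)
    then have I: "I = {k. equivalent_facets \<eta> \<kappa> x k}" by auto
    have "i \<in> I \<longleftrightarrow> j \<in> I" unfolding I using e equivalent_facets_trans by blast
    then show ?thesis by (simp add: \<beta>_def sum_subtractf)
  qed
  then show ?thesis using H unfolding inessential_def by blast
qed

lemma mass_coeffs_cancel:
  assumes m: "mass_coeffs \<eta> \<kappa> H \<gamma> C" and ij: "i \<noteq> j"
    and c: "\<And>\<kappa>'. \<kappa>' \<in> chamber \<eta> \<kappa> \<Longrightarrow> (\<eta> i - \<eta> j) \<bullet> center_of_mass (polytope_of \<eta> \<kappa>') = \<kappa>' $ i - \<kappa>' $ j"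
  shows "mass_coeffs \<eta> \<kappa> (H - \<gamma> i *\<^sub>R (\<eta> i - \<eta> j)) (\<gamma>(i := 0, j := \<gamma> j + \<gamma> i)) C"
  unfolding mass_coeffs_def
proof
  fix \<kappa>' assume k: "\<kappa>' \<in> chamber \<eta> \<kappa>"
  have "(\<Sum>k\<in>UNIV. (\<gamma>(i := 0, j := \<gamma> j + \<gamma> i)) k * \<kappa>' $ k) =
     (\<Sum>k\<in>UNIV. \<gamma> k * \<kappa>' $ k - (if k = i then \<gamma> i * \<kappa>' $ i else 0) + (if k = j then \<gamma> i * \<kappa>' $ j else 0))"
    by (rule sum.cong) (use ij in \<open>auto simp: algebra_simps\<close>)
  also have "\<dots> = (\<Sum>k\<in>UNIV. \<gamma> k * \<kappa>' $ k) - \<gamma> i * (\<kappa>' $ i - \<kappa>' $ j)"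
    by (simp add: sum.distrib sum_subtractf algebra_simps)
  finally have s: "(\<Sum>k\<in>UNIV. (\<gamma>(i := 0, j := \<gamma> j + \<gamma> i)) k * \<kappa>' $ k) =
     (\<Sum>k\<in>UNIV. \<gamma> k * \<kappa>' $ k) - \<gamma> i * (\<kappa>' $ i - \<kappa>' $ j)" .
  have "H \<bullet> center_of_mass (polytope_of \<eta> \<kappa>') = (\<Sum>k\<in>UNIV. \<gamma> k * \<kappa>' $ k) + C"
    using m k unfolding mass_coeffs_def by blast
  then show "(H - \<gamma> i *\<^sub>R (\<eta> i - \<eta> j)) \<bullet> center_of_mass (polytope_of \<eta> \<kappa>') =
    (\<Sum>k\<in>UNIV. (\<gamma>(i := 0, j := \<gamma> j + \<gamma> i)) k * \<kappa>' $ k) + C"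
    unfolding s inner_diff_left[of H] inner_scaleR_left c[OF k] by simp
qed

text \<open>
  Induction on the number of nonpervasive facets with nonzero coefficient.  Subtracting
  \<open>\<gamma> i *\<^sub>R (\<eta> i - \<eta> j)\<close> makes the coefficient at \<open>i\<close> vanish, and then by \<open>disjoint_signs\<close> also the
  one at \<open>j\<close>, so no new nonpervasive facet with nonzero coefficient is created.
\<close>

lemma remove_nonpervasive:
  assumes S: "simple_polytope \<eta> \<kappa>" and N: "normalized_conormals \<eta> \<kappa>" and m: "mass_coeffs \<eta> \<kappa> H \<gamma> C"
  shows "\<exists>H' \<gamma>'. inessential \<eta> \<kappa> H' \<and> mass_coeffs \<eta> \<kappa> (H - H') \<gamma>' C \<and> (\<forall>i. \<gamma>' i \<noteq> 0 \<longrightarrow> pervasive_facet \<eta> \<kappa> i)"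
  using m
proof (induction "card {i. \<gamma> i \<noteq> 0 \<and> \<not> pervasive_facet \<eta> \<kappa> i}" arbitrary: H \<gamma> rule: less_induct)
  case less
  show ?case
  proof (cases "\<forall>i. \<gamma> i \<noteq> 0 \<longrightarrow> pervasive_facet \<eta> \<kappa> i")
    case True
    have "inessential \<eta> \<kappa> 0" unfolding inessential_def by (intro exI[of _ "\<lambda>_. 0"]) simp
    then show ?thesis using less.prems True by (intro exI[of _ 0] exI[of _ \<gamma>]) simp
  next
    case False
    then obtain i where i: "\<gamma> i \<noteq> 0" "\<not> pervasive_facet \<eta> \<kappa> i" by blast
    then obtain j where j: "j \<noteq> i" "facet \<eta> \<kappa> i \<inter> facet \<eta> \<kappa> j = {}" unfolding pervasive_facet_def by blast
    note ij = j(1)[symmetric]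
    note pair = disjoint_asymmetric_pair[OF S N less.prems ij j(2) i(1)]
    let ?H = "\<gamma> i *\<^sub>R (\<eta> i - \<eta> j)"
    define \<gamma>' where "\<gamma>' = \<gamma>(i := 0, j := \<gamma> j + \<gamma> i)"
    have m': "mass_coeffs \<eta> \<kappa> (H - ?H) \<gamma>' C" unfolding \<gamma>'_def by (rule mass_coeffs_cancel[OF less.prems ij pair(3)])
    have gi: "\<gamma>' i = 0" using ij by (simp add: \<gamma>'_def)
    have gj: "\<gamma>' j = 0"
    proof (rule ccontr)
      assume "\<gamma>' j \<noteq> 0"
      moreover have "facet \<eta> \<kappa> j \<inter> facet \<eta> \<kappa> i = {}" using j(2) by blast
      ultimately have "\<gamma>' j * \<gamma>' i < 0" using disjoint_signs[OF S m' j(1)] by blast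
      then show False using gi by simp
    qed
    have "\<gamma>' k \<noteq> 0 \<Longrightarrow> \<gamma> k \<noteq> 0" for k using gi gj by (cases "k = i"; cases "k = j") (auto simp: \<gamma>'_def)
    then have "{k. \<gamma>' k \<noteq> 0 \<and> \<not> pervasive_facet \<eta> \<kappa> k} \<subset> {k. \<gamma> k \<noteq> 0 \<and> \<not> pervasive_facet \<eta> \<kappa> k}"
      using i gi by blast
    then have "card {k. \<gamma>' k \<noteq> 0 \<and> \<not> pervasive_facet \<eta> \<kappa> k} < card {k. \<gamma> k \<noteq> 0 \<and> \<not> pervasive_facet \<eta> \<kappa> k}"
      by (intro psubset_card_mono) simp_all
    from less.hyps[OF this m'] obtain H' \<gamma>'' where h: "inessential \<eta> \<kappa> H'" "mass_coeffs \<eta> \<kappa> (H - ?H - H') \<gamma>'' C"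
      "\<forall>i. \<gamma>'' i \<noteq> 0 \<longrightarrow> pervasive_facet \<eta> \<kappa> i" by blast
    have "inessential \<eta> \<kappa> (?H + H')" by (rule inessential_add[OF inessential_difference[OF ij pair(1,2)] h(1)])
    moreover have "mass_coeffs \<eta> \<kappa> (H - (?H + H')) \<gamma>'' C" using h(2) by (simp add: diff_diff_eq)
    ultimately show ?thesis using h(3) by blast
  qed
qed

theorem proposition3p25:
  fixes \<eta> :: "'n::finite \<Rightarrow> 'a::euclidean_space" and \<kappa> :: "real ^ 'n" and H :: 'a
  assumes "simple_polytope \<eta> \<kappa>"
    and "normalized_conormals \<eta> \<kappa>"
    and "mass_linear \<eta> \<kappa> H"
  shows "\<exists>H'. inessential \<eta> \<kappa> H' \<and> mass_linear \<eta> \<kappa> (H - H') \<and>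
           (\<forall>i. asymmetric_facet \<eta> \<kappa> (H - H') i \<longrightarrow> pervasive_facet \<eta> \<kappa> i)"
proof -
  obtain \<gamma> C where "mass_coeffs \<eta> \<kappa> H \<gamma> C"
    using assms(3) unfolding mass_linear_def mass_coeffs_def by blast
  from remove_nonpervasive[OF assms(1,2) this]
  obtain H' \<gamma>' where h: "inessential \<eta> \<kappa> H'" "mass_coeffs \<eta> \<kappa> (H - H') \<gamma>' C"
      "\<forall>i. \<gamma>' i \<noteq> 0 \<longrightarrow> pervasive_facet \<eta> \<kappa> i" by blast
  have "mass_linear \<eta> \<kappa> (H - H')" using h(2) unfolding mass_linear_def mass_coeffs_def by blast
  moreover have "\<forall>i. asymmetric_facet \<eta> \<kappa> (H - H') i \<longrightarrow> pervasive_facet \<eta> \<kappa> i"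
    using h(3) symmetric_facet_iff_coeff[OF assms(1) h(2)] by blast
  ultimately show ?thesis using h(1) by blast
qed

end
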